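(* Let $L_1,L_2$ be relational signatures with $L_1\cap L_2=\{\prec\}$. Let $\mathcal{N}$ be an $L_2$-structure linearly ordered by $\prec$, and let $(\mathcal{M}_i)_{i\in\mathcal{N}}$ be $L_1$-structures on pairwise-disjoint domains, each linearly ordered by $\prec$. Let $\mathcal{I}=\mathcal{I}_{i\in\mathcal{N}}(\mathcal{M}_i)$ be the semi-direct product structure. Assume that there is an age $\mathcal{K}$ that has the Ramsey property (RP) and such that $\mathrm{age}(\mathcal{M}_i)=\mathcal{K}$ for all $i\in\mathcal{N}$. If $\mathcal{N}$ has RP, then $\mathcal{I}$ has RP.
   Context: Write $|\mathcal{M}|$ for the underlying set of $\mathcal{M}$. Semi-direct product structure: with $L_1,L_2,\mathcal{N},(\mathcal{M}_i)_{i\in\mathcal{N}}$ as in the claim, $\mathcal{I}_{i\in\mathcal{N}}(\mathcal{M}_i)$ is the structure on $\bigcup_{i\in\mathcal{N}}|\mathcal{M}_i|$ in the signature $L_1\cup L_2\cup\{E\}$, with $E$ a new binary relation symbol, interpreted as follows. (i) For each $S\in L_1\setminus\{\prec\}$, $S^{\mathcal{I}}=\bigcup_{i\in\mathcal{N}}S^{\mathcal{M}_i}$. (ii) For each $n$-ary $R\in L_2\setminus\{\prec\}$, $R^{\mathcal{I}}(a_0,\dots,a_{n-1})$ holds iff there are (possibly non-distinct) $t_0,\dots,t_{n-1}\in\mathcal{N}$ with $a_i\in\mathcal{M}_{t_i}$ for all $i<n$ and $\mathcal{N}\models R(t_0,\dots,t_{n-1})$. (iii) $E^{\mathcal{I}}(a,b)$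 iff there is $i\in\mathcal{N}$ with $a,b\in\mathcal{M}_i$. (iv) $a\prec^{\mathcal{I}}b$ iff there are $i,j\in\mathcal{N}$ with $a\in\mathcal{M}_i$, $b\in\mathcal{M}_j$ and either $i\prec^{\mathcal{N}}j$, or $i=j$ and $a\prec^{\mathcal{M}_i}b$. Ramsey property: the age of a relational structure is the class of all its finite substructures, up to isomorphism. $\binom{\mathcal{B}}{\mathcal{A}}$ denotes the set of substructures of $\mathcal{B}$ isomorphic to $\mathcal{A}$. A class $\mathcal{K}$ of finite structures has RP if for all $\mathcal{A},\mathcal{B}\in\mathcal{K}$ and every integer $k\ge 2$ there is $\mathcal{C}\in\mathcal{K}$ such that for every function $c:\binom{\mathcal{C}}{\mathcal{A}}\to\{0,\dots,k-1\}$ there is $\mathcal{B}'\in\binom{\mathcal{C}}{\mathcal{B}}$ such that $c$ is constant on $\binom{\mathcal{B}'}{\mathcal{A}}$. A relational structure has RP if its age has RP. *)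

theory Defs
  imports "HOL-Library.Disjoint_Sets"
begin

text \<open>
  A relational signature is a set of symbols \<open>L :: 's set\<close> whose arities are given by a
  function \<open>ar :: 's \<Rightarrow> nat\<close> common to all signatures. Tuples are lists.
\<close>

record ('a, 's) rstruct =
  univ :: "'a set"
  interp :: "'s \<Rightarrow> 'a list set"

text \<open>
  Symbols outside \<open>L\<close> get the empty interpretation, so that two \<open>L\<close>-structures are equal
  as HOL values iff they have the same underlying set and the same relations. The empty structure
  and nullary symbols are allowed.
\<close>

definition is_rstruct :: "('s \<Rightarrow> nat) \<Rightarrow> 's set \<Rightarrow> ('a, 's) rstruct \<Rightarrow> bool" where
  "is_rstruct ar L M \<longleftrightarrow>
     (\<forall>S\<in>L. \<forall>as\<in>interp M S. length as = ar S \<and> set as \<subseteq> univ M) \<and>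
     (\<forall>S. S \<notin> L \<longrightarrow> interp M S = {})"

definition ordered_by :: "'s \<Rightarrow> ('a, 's) rstruct \<Rightarrow> bool" where
  "ordered_by p M \<longleftrightarrow> strict_linear_order_on (univ M) {(a, b). [a, b] \<in> interp M p}"

definition is_substruct :: "('a, 's) rstruct \<Rightarrow> ('a, 's) rstruct \<Rightarrow> bool" where
  "is_substruct A M \<longleftrightarrow>
     univ A \<subseteq> univ M \<and> (\<forall>S. interp A S = {as \<in> interp M S. set as \<subseteq> univ A})"

definition isomorphic ::
  "('s \<Rightarrow> nat) \<Rightarrow> 's set \<Rightarrow> ('a, 's) rstruct \<Rightarrow> ('b, 's) rstruct \<Rightarrow> bool" where
  "isomorphic ar L A B \<longleftrightarrow>
     (\<exists>f. bij_betw f (univ A) (univ B) \<and>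
          (\<forall>S\<in>L. \<forall>as. length as = ar S \<and> set as \<subseteq> univ A \<longrightarrow>
             (as \<in> interp A S \<longleftrightarrow> map f as \<in> interp B S)))"

text \<open>
  Every finite structure is isomorphic to one whose underlying set consists of natural numbers.
  A class of finite structures closed under isomorphism is represented by the set of its members
  of this kind, which makes the ages of structures over different types comparable.
\<close>

definition age ::
  "('s \<Rightarrow> nat) \<Rightarrow> 's set \<Rightarrow> ('a, 's) rstruct \<Rightarrow> (nat, 's) rstruct set" where
  "age ar L M =
     {A. is_rstruct ar L A \<and> finite (univ A) \<and>
         (\<exists>B. is_substruct B M \<and> isomorphic ar L A B)}"

definition copies ::
  "('s \<Rightarrow> nat) \<Rightarrow> 's set \<Rightarrow> ('a, 's) rstruct \<Rightarrow> ('a, 's) rstruct \<Rightarrow> ('a, 's) rstruct set" where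
  "copies ar L B A = {A'. is_substruct A' B \<and> isomorphic ar L A' A}"

definition class_RP :: "('s \<Rightarrow> nat) \<Rightarrow> 's set \<Rightarrow> (nat, 's) rstruct set \<Rightarrow> bool" where
  "class_RP ar L K \<longleftrightarrow>
     (\<forall>A\<in>K. \<forall>B\<in>K. \<forall>k::nat. 2 \<le> k \<longrightarrow>
        (\<exists>C\<in>K. \<forall>c. c \<in> copies ar L C A \<rightarrow> {0..<k} \<longrightarrow>
           (\<exists>B'\<in>copies ar L C B. \<exists>j. \<forall>A'\<in>copies ar L B' A. c A' = j)))"

definition RP :: "('s \<Rightarrow> nat) \<Rightarrow> 's set \<Rightarrow> ('a, 's) rstruct \<Rightarrow> bool" where
  "RP ar L M \<longleftrightarrow> class_RP ar L (age ar L M)"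

definition semidirect ::
  "('s \<Rightarrow> nat) \<Rightarrow> 's set \<Rightarrow> 's set \<Rightarrow> 's \<Rightarrow> 's \<Rightarrow> ('i, 's) rstruct \<Rightarrow>
   ('i \<Rightarrow> ('a, 's) rstruct) \<Rightarrow> ('a, 's) rstruct" where
  "semidirect ar L1 L2 p E N M =
     \<lparr>univ = (\<Union>i\<in>univ N. univ (M i)),
      interp = (\<lambda>S.
        if S = p then
          {[a, b] | a b. \<exists>i\<in>univ N. \<exists>j\<in>univ N. a \<in> univ (M i) \<and> b \<in> univ (M j) \<and>
             ([i, j] \<in> interp N p \<or> i = j \<and> [a, b] \<in> interp (M i) p)}
        else if S = E then
          {[a, b] | a b. \<exists>i\<in>univ N. a \<in> univ (M i) \<and> b \<in> univ (M i)}
        else if S \<in> L1 then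
          (\<Union>i\<in>univ N. interp (M i) S)
        else if S \<in> L2 then
          {as. length as = ar S \<and>
             (\<exists>ts. length ts = ar S \<and> set ts \<subseteq> univ N \<and>
                (\<forall>k<ar S. as ! k \<in> univ (M (ts ! k))) \<and> ts \<in> interp N S)}
        else {})\<rparr>"

lemma is_rstruct_semidirect:
  assumes "L1 \<inter> L2 = {p}" "E \<notin> L1 \<union> L2" "ar p = 2" "ar E = 2"
    and "\<And>i. i \<in> univ N \<Longrightarrow> is_rstruct ar L1 (M i)"
  shows "is_rstruct ar (L1 \<union> L2 \<union> {E}) (semidirect ar L1 L2 p E N M)"
proof -
  have L2_univ: "\<exists>i\<in>univ N. a \<in> univ (M i)"
    if "length as = n" "length ts = n" "set ts \<subseteq> univ N"
      "\<forall>k<n. as ! k \<in> univ (M (ts ! k))" "a \<in> set as" for as ts n a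
    using that by (metis in_set_conv_nth nth_mem subsetD)
  have p_in: "p \<in> L1" "p \<in> L2" using assms(1) by auto
  have L1_in: "length as = ar S \<and> set as \<subseteq> univ (M i)"
    if "i \<in> univ N" "S \<in> L1" "as \<in> interp (M i) S" for i S as
    using assms(5)[OF that(1)] that unfolding is_rstruct_def by blast
  show ?thesis
    unfolding is_rstruct_def
  proof (intro conjI ballI allI impI)
    fix S as assume S: "S \<in> L1 \<union> L2 \<union> {E}"
      and as: "as \<in> interp (semidirect ar L1 L2 p E N M) S"
    show "length as = ar S"
      using as L1_in assms(3,4) by (auto simp: semidirect_def split: if_splits)
    show "set as \<subseteq> univ (semidirect ar L1 L2 p E N M)"
    proof
      fix a assume "a \<in> set as"
      then show "a \<in> univ (semidirect ar L1 L2 p E N M)"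
        using as by (auto simp: semidirect_def split: if_splits dest: L1_in L2_univ)
    qed
  next
    fix S assume "S \<notin> L1 \<union> L2 \<union> {E}"
    then show "interp (semidirect ar L1 L2 p E N M) S = {}"
      using p_in by (auto simp: semidirect_def)
  qed
qed

end

theory Submission
  imports Defs
begin

text \<open>
  The equivalence relation \<open>E\<close> makes a finite substructure \<open>A\<close> of the semidirect product the same
  thing as a finite set of indices in \<open>N\<close> together with a nonempty finite substructure of \<open>M l\<close> for
  each of these indices \<open>l\<close>. A copy of \<open>A\<close> is a copy \<open>T\<close> of its index set together with copies of its
  fibres, placed over the corresponding elements of \<open>T\<close> (lemmas \<open>copy_decomposes\<close> and
  \<open>copies_glue\<close>). Which fibre belongs over which element of \<open>T\<close> is determined by \<open>T\<close>, because \<open>N\<close> is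
  linearly ordered and finite linear orders are rigid (\<open>ordered_iso_unique\<close>).

  Given \<open>A\<close>, \<open>B\<close> and \<open>k\<close>, the Ramsey property of \<open>N\<close> yields a finite \<open>CN\<close> that arrows the index set of
  \<open>B\<close> for copies of the index set of \<open>A\<close>. For a fixed copy \<open>T\<close>, the copies of \<open>A\<close> over \<open>T\<close> form a product
  of families of copies, one in each fibre. The product Ramsey theorem (\<open>product_ramsey\<close>), applied
  to all the finitely many \<open>T\<close> at once, yields fibres over \<open>CN\<close> in which, for every colouring, large
  subfibres can be found such that the colour of a copy of \<open>A\<close> in them depends only on its index set
  \<open>T\<close>. This is a colouring of copies in \<open>CN\<close>, and the choice of \<open>CN\<close> makes it constant on some copy of
  the index set of \<open>B\<close>. The subfibres over it contain a copy of \<open>B\<close>, because they were chosen large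
  enough to contain a copy of every fibre of \<open>B\<close>; here the equality of the ages is essential. All
  copies of \<open>A\<close> in this copy of \<open>B\<close> have the same colour.

  To avoid moving between structures on different types, the Ramsey property of an age is
  expressed by finite subsets of one structure (\<open>ramsey\<close>, \<open>class_RP_age_iff\<close>).
\<close>

section \<open>Copies and the partition arrow inside one structure\<close>

text \<open>
  Isomorphism between the substructures induced on two subsets, stated directly for subsets: all
  structures below are handled through the subsets of one ambient structure that carry them.
\<close>

definition iso_on ::
  "('s \<Rightarrow> nat) \<Rightarrow> 's set \<Rightarrow> ('a \<Rightarrow> 'b) \<Rightarrow> ('a, 's) rstruct \<Rightarrow> 'a set \<Rightarrow> ('b, 's) rstruct \<Rightarrow> 'b set \<Rightarrow> bool" where
  "iso_on ar L f M X M' Y \<longleftrightarrow>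
     bij_betw f X Y \<and>
     (\<forall>S\<in>L. \<forall>as. length as = ar S \<longrightarrow> set as \<subseteq> X \<longrightarrow> (as \<in> interp M S \<longleftrightarrow> map f as \<in> interp M' S))"

lemma iso_onD:
  assumes "iso_on ar L f M X M' Y"
  shows "bij_betw f X Y" "inj_on f X" "f ` X = Y"
    and "S \<in> L \<Longrightarrow> length as = ar S \<Longrightarrow> set as \<subseteq> X \<Longrightarrow> as \<in> interp M S \<longleftrightarrow> map f as \<in> interp M' S"
  using assms by (auto simp: iso_on_def bij_betw_def)

lemma iso_on_id: "iso_on ar L id M X M X"
  by (simp add: iso_on_def)

lemma iso_on_inv:
  assumes "iso_on ar L f M X M' Y"
  shows "iso_on ar L (inv_into X f) M' Y M X"
  unfolding iso_on_def
proof (intro conjI ballI allI impI)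
  note f = iso_onD[OF assms]
  show "bij_betw (inv_into X f) Y X"
    using f(1) by (rule bij_betw_inv_into)
  fix S bs assume S: "S \<in> L" and len: "length bs = ar S" and bs: "set bs \<subseteq> Y"
  have "map f (map (inv_into X f) bs) = bs"
    using bs f(3) by (auto simp: map_idI f_inv_into_f subset_iff)
  moreover have "set (map (inv_into X f) bs) \<subseteq> X"
    using bs f(3) by (auto simp: inv_into_into subset_iff)
  ultimately show "bs \<in> interp M' S \<longleftrightarrow> map (inv_into X f) bs \<in> interp M S"
    using f(4)[OF S, of "map (inv_into X f) bs"] len by simp
qed

lemma iso_on_comp:
  assumes f: "iso_on ar L f M X M' Y" and g: "iso_on ar L g M' Y M'' Z"
  shows "iso_on ar L (g \<circ> f) M X M'' Z"
  unfolding iso_on_def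
proof (intro conjI ballI allI impI)
  show "bij_betw (g \<circ> f) X Z"
    using iso_onD(1)[OF f] iso_onD(1)[OF g] by (rule bij_betw_trans)
  fix S as assume *: "S \<in> L" "length as = ar S" "set as \<subseteq> X"
  then have "set (map f as) \<subseteq> Y" using iso_onD(3)[OF f] by auto
  then show "as \<in> interp M S \<longleftrightarrow> map (g \<circ> f) as \<in> interp M'' S"
    using iso_onD(4)[OF f *] iso_onD(4)[OF g, of S "map f as"] * by simp
qed

lemma iso_on_subset:
  assumes "iso_on ar L f M X M' Y" "X' \<subseteq> X"
  shows "iso_on ar L f M X' M' (f ` X')"
  using assms by (auto simp: iso_on_def bij_betw_def inj_on_subset)

lemma isomorphic_iff: "isomorphic ar L A B \<longleftrightarrow> (\<exists>f. iso_on ar L f A (univ A) B (univ B))"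
  by (auto simp: isomorphic_def iso_on_def)

lemma isomorphic_refl: "isomorphic ar L A A"
  unfolding isomorphic_iff by (rule exI, rule iso_on_id)

lemma isomorphic_sym: "isomorphic ar L A B \<Longrightarrow> isomorphic ar L B A"
  unfolding isomorphic_iff by (elim exE) (rule exI, erule iso_on_inv)

lemma isomorphic_sym_iff: "isomorphic ar L A B \<longleftrightarrow> isomorphic ar L B A"
  by (rule iffI) (rule isomorphic_sym, assumption)+

lemma isomorphic_trans: "isomorphic ar L A B \<Longrightarrow> isomorphic ar L B C \<Longrightarrow> isomorphic ar L A C"
  unfolding isomorphic_iff by (elim exE) (rule exI, erule (1) iso_on_comp)

definition induced :: "('a, 's) rstruct \<Rightarrow> 'a set \<Rightarrow> ('a, 's) rstruct" where
  "induced M X = \<lparr>univ = X, interp = (\<lambda>S. {as \<in> interp M S. set as \<subseteq> X})\<rparr>"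

lemma univ_induced [simp]: "univ (induced M X) = X"
  by (simp add: induced_def)

lemma induced_induced: "X \<subseteq> Y \<Longrightarrow> induced (induced M Y) X = induced M X"
  by (auto simp: induced_def)

lemma is_substruct_iff: "is_substruct A M \<longleftrightarrow> (\<exists>X\<subseteq>univ M. A = induced M X)"
  by (auto simp: is_substruct_def induced_def intro!: exI[of _ "univ A"] rstruct.equality)

lemma iso_on_induced_left: "iso_on ar L f (induced M X) X M' Y \<longleftrightarrow> iso_on ar L f M X M' Y"
  by (auto simp: iso_on_def induced_def)

lemma iso_on_induced_right: "iso_on ar L f M X (induced M' Y) Y \<longleftrightarrow> iso_on ar L f M X M' Y"
  by (auto simp: iso_on_def induced_def bij_betw_def)

lemmas iso_on_induced = iso_on_induced_left iso_on_induced_right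

text \<open>
  A substructure is determined by its underlying set, so the copies of \<open>A\<close> in \<open>M\<close> are represented
  by their underlying sets. The structure \<open>A\<close> need not lie in \<open>M\<close> and may live on another type,
  like the members of an age.
\<close>

definition realizations ::
  "('s \<Rightarrow> nat) \<Rightarrow> 's set \<Rightarrow> ('a, 's) rstruct \<Rightarrow> ('b, 's) rstruct \<Rightarrow> 'a set set" where
  "realizations ar L M A = {X. X \<subseteq> univ M \<and> isomorphic ar L (induced M X) A}"

lemma realizationsI:
  "X \<subseteq> univ M \<Longrightarrow> iso_on ar L f A (univ A) M X \<Longrightarrow> X \<in> realizations ar L M A"
  unfolding realizations_def mem_Collect_eq
  by (intro conjI isomorphic_sym[of ar L A]) (auto simp: isomorphic_iff iso_on_induced)

lemma realizationsE:
  assumes "X \<in> realizations ar L M A"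
  obtains f where "X \<subseteq> univ M" "iso_on ar L f A (univ A) M X"
  using assms isomorphic_sym[of ar L "induced M X" A]
  by (auto simp: realizations_def isomorphic_iff iso_on_induced)

lemma realizations_induced_iff:
  "Y \<in> realizations ar L M (induced M' X) \<longleftrightarrow> Y \<subseteq> univ M \<and> (\<exists>f. iso_on ar L f M' X M Y)"
proof
  assume "Y \<in> realizations ar L M (induced M' X)"
  then show "Y \<subseteq> univ M \<and> (\<exists>f. iso_on ar L f M' X M Y)"
    by (rule realizationsE) (auto simp: iso_on_induced)
next
  assume "Y \<subseteq> univ M \<and> (\<exists>f. iso_on ar L f M' X M Y)"
  then obtain f where f: "Y \<subseteq> univ M" "iso_on ar L f M' X M Y" by blast
  show "Y \<in> realizations ar L M (induced M' X)"
    by (rule realizationsI[OF f(1), where f = f]) (simp add: iso_on_induced f(2))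
qed

lemma realizations_self: "X \<subseteq> univ M \<Longrightarrow> X \<in> realizations ar L M (induced M X)"
  by (simp add: realizations_def isomorphic_refl)

lemma realizations_cong:
  "isomorphic ar L A B \<Longrightarrow> realizations ar L M A = realizations ar L M B"
  unfolding realizations_def by (metis isomorphic_trans isomorphic_sym)

lemma realizations_induced:
  "X \<in> realizations ar L M A \<Longrightarrow> realizations ar L M (induced M X) = realizations ar L M A"
  by (rule realizations_cong) (simp add: realizations_def)

lemma realizations_empty:
  assumes "X \<in> realizations ar L M (induced M' {})" shows "X = {}"
proof -
  obtain f where "iso_on ar L f (induced M' {}) {} M X"
    using assms by (auto elim: realizationsE)
  from iso_onD(3)[OF this] show ?thesis by auto
qed

lemma realizations_image_iff:
  assumes f: "iso_on ar L f M C M' C'" and "C \<subseteq> univ M" "C' \<subseteq> univ M'" "X \<subseteq> C"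
  shows "f ` X \<in> realizations ar L M' A \<longleftrightarrow> X \<in> realizations ar L M A"
proof -
  have "iso_on ar L f M X M' (f ` X)" using f assms(4) by (rule iso_on_subset)
  then have "isomorphic ar L (induced M X) (induced M' (f ` X))"
    by (auto simp: isomorphic_iff iso_on_induced)
  moreover have "f ` X \<subseteq> univ M'" "X \<subseteq> univ M"
    using iso_onD(3)[OF f] assms by auto
  ultimately show ?thesis
    unfolding realizations_def mem_Collect_eq by (metis isomorphic_trans isomorphic_sym)
qed

text \<open>
  The isomorphism from \<open>D\<close> to its copy \<open>Y\<close> carries \<open>X\<close> along.
\<close>

lemma realization_in_copy:
  assumes "Y \<in> realizations ar L M (induced M D)" "D \<subseteq> univ M" "X \<subseteq> D" "X \<in> realizations ar L M A"
  shows "\<exists>Z\<subseteq>Y. Z \<in> realizations ar L M A"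
proof -
  obtain f where f: "iso_on ar L f M D M Y" and Y: "Y \<subseteq> univ M"
    using assms(1) by (auto elim: realizationsE simp: iso_on_induced)
  then have "f ` X \<in> realizations ar L M A"
    using realizations_image_iff[OF f assms(2) Y assms(3), of A] assms(4) by simp
  then show ?thesis using iso_onD(3)[OF f] assms(3) by blast
qed

text \<open>
  The partition arrow \<open>C \<longrightarrow> (B)\<^sup>A\<^sub>k\<close>, where \<open>\<A>\<close> and \<open>\<B>\<close> are the families of copies of \<open>A\<close> and \<open>B\<close>.
\<close>

definition arrow :: "nat \<Rightarrow> 'a set \<Rightarrow> 'a set set \<Rightarrow> 'a set set \<Rightarrow> bool" where
  "arrow k C \<A> \<B> \<longleftrightarrow>
     (\<forall>c. c \<in> Pow C \<inter> \<A> \<rightarrow> {..<k} \<longrightarrow>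
        (\<exists>Y\<in>Pow C \<inter> \<B>. \<exists>x. \<forall>X\<in>Pow Y \<inter> \<A>. c X = x))"

lemma arrowE:
  assumes "arrow k C \<A> \<B>" "c \<in> Pow C \<inter> \<A> \<rightarrow> {..<k}"
  obtains Y x where "Y \<subseteq> C" "Y \<in> \<B>" "\<And>X. X \<subseteq> Y \<Longrightarrow> X \<in> \<A> \<Longrightarrow> c X = x"
  using assms(1)[unfolded arrow_def, rule_format, OF assms(2)] that by blast

lemma arrow_fewer_colours: "arrow k C \<A> \<B> \<Longrightarrow> l \<le> k \<Longrightarrow> arrow l C \<A> \<B>"
  unfolding arrow_def
  using Pi_mono[of "Pow C \<inter> \<A>" "\<lambda>_. {..<l}" "\<lambda>_. {..<k}"] by (auto simp: subset_iff)

text \<open>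
  A colouring of the copies in \<open>C'\<close> is pulled back along the isomorphism \<open>f\<close>, and a homogeneous
  copy is pushed forward.
\<close>

lemma arrow_iso:
  assumes f: "iso_on ar L f M C M' C'" and C: "C \<subseteq> univ M" and C': "C' \<subseteq> univ M'"
    and arrow: "arrow k C (realizations ar L M A) (realizations ar L M B)"
  shows "arrow k C' (realizations ar L M' A) (realizations ar L M' B)"
  unfolding arrow_def
proof (intro allI impI)
  fix c assume c: "c \<in> Pow C' \<inter> realizations ar L M' A \<rightarrow> {..<k}"
  note img = realizations_image_iff[OF f C C']
  have fC: "f ` C = C'" using iso_onD(3)[OF f] .
  have "(\<lambda>X. c (f ` X)) \<in> Pow C \<inter> realizations ar L M A \<rightarrow> {..<k}"
    using c img fC by blast
  then obtain Y x where Y: "Y \<subseteq> C" "Y \<in> realizations ar L M B"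
    and x: "\<And>X. X \<subseteq> Y \<Longrightarrow> X \<in> realizations ar L M A \<Longrightarrow> c (f ` X) = x"
    by (rule arrowE[OF arrow]) (rule that)
  have "c X' = x" if X': "X' \<subseteq> f ` Y" "X' \<in> realizations ar L M' A" for X'
  proof -
    obtain X where "X \<subseteq> Y" "X' = f ` X" by (rule subset_imageE[OF X'(1)])
    then show ?thesis using x X'(2) Y(1) img[of X A] by auto
  qed
  then show "\<exists>Y\<in>Pow C' \<inter> realizations ar L M' B. \<exists>x. \<forall>X\<in>Pow Y \<inter> realizations ar L M' A. c X = x"
    using Y img[OF Y(1), of B] fC by (intro bexI[of _ "f ` Y"]) auto
qed

text \<open>
  The Ramsey property of the age of \<open>M\<close>, with all three structures taken inside \<open>M\<close>. The
  number of colours is arbitrary, since an arrow for two colours implies the arrow for fewer.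
\<close>

definition ramsey :: "('s \<Rightarrow> nat) \<Rightarrow> 's set \<Rightarrow> ('a, 's) rstruct \<Rightarrow> bool" where
  "ramsey ar L M \<longleftrightarrow>
     (\<forall>X Y k. finite X \<and> X \<subseteq> univ M \<and> finite Y \<and> Y \<subseteq> univ M \<longrightarrow>
        (\<exists>C. finite C \<and> C \<subseteq> univ M \<and>
           arrow k C (realizations ar L M (induced M X)) (realizations ar L M (induced M Y))))"

lemma arrow_iff_copies:
  fixes A B C :: "('a, 's) rstruct"
  shows "arrow k (univ C) (realizations ar L C A) (realizations ar L C B) \<longleftrightarrow>
    (\<forall>c. c \<in> copies ar L C A \<rightarrow> {0..<k} \<longrightarrow>
       (\<exists>B'\<in>copies ar L C B. \<exists>j. \<forall>A'\<in>copies ar L B' A. c A' = j))" (is "?l \<longleftrightarrow> ?r")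
proof -
  have cop: "copies ar L C A = induced C ` realizations ar L C A" for A :: "('a, 's) rstruct"
    by (auto simp: copies_def is_substruct_iff realizations_def)
  have cop_sub: "copies ar L (induced C Y) A = induced C ` (Pow Y \<inter> realizations ar L C A)"
    if "Y \<subseteq> univ C" for Y
    using that by (auto simp: copies_def is_substruct_iff realizations_def induced_induced)
  have Y: "Y \<subseteq> univ C" if "Y \<in> realizations ar L C B" for Y
    using that by (simp add: realizations_def)
  have Pow: "Pow (univ C) \<inter> realizations ar L C D = realizations ar L C D" for D :: "('a, 's) rstruct"
    by (auto simp: realizations_def)
  show ?thesis
  proof
    assume l: ?l
    show ?r
    proof (intro allI impI)
      fix c assume "c \<in> copies ar L C A \<rightarrow> {0..<k}"
      then have "(\<lambda>X. c (induced C X)) \<in> Pow (univ C) \<inter> realizations ar L C A \<rightarrow> {..<k}"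
        by (auto simp: cop)
      with l obtain Y x where "Y \<in> realizations ar L C B"
        "\<forall>X\<in>Pow Y \<inter> realizations ar L C A. c (induced C X) = x"
        unfolding arrow_def Pow by (elim allE[of _ "\<lambda>X. c (induced C X)"]) auto
      then show "\<exists>B'\<in>copies ar L C B. \<exists>j. \<forall>A'\<in>copies ar L B' A. c A' = j"
        unfolding cop using Y by (intro bexI[of _ "induced C Y"]) (auto simp: cop_sub)
    qed
  next
    assume r: ?r
    show ?l
      unfolding arrow_def
    proof (intro allI impI)
      fix c assume "c \<in> Pow (univ C) \<inter> realizations ar L C A \<rightarrow> {..<k}"
      then have "(\<lambda>A'. c (univ A')) \<in> copies ar L C A \<rightarrow> {0..<k}"
        unfolding Pow by (auto simp: cop)
      with r obtain Y x where "Y \<in> realizations ar L C B"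
        "\<forall>A'\<in>copies ar L (induced C Y) A. c (univ A') = x"
        unfolding cop[of B] by (elim allE[of _ "\<lambda>A'. c (univ A')"]) auto
      then show "\<exists>Y\<in>Pow (univ C) \<inter> realizations ar L C B. \<exists>x. \<forall>X\<in>Pow Y \<inter> realizations ar L C A. c X = x"
        unfolding Pow using Y by (intro bexI[of _ Y]) (auto simp: cop_sub)
    qed
  qed
qed

lemma in_age_iff:
  "A \<in> age ar L M \<longleftrightarrow> is_rstruct ar L A \<and> finite (univ A) \<and> realizations ar L M A \<noteq> {}"
  by (auto simp: age_def is_substruct_iff realizations_def isomorphic_sym_iff[of ar L A])

lemma finite_realization:
  assumes "X \<in> realizations ar L M A" shows "finite X \<longleftrightarrow> finite (univ A)"
  using assms by (auto elim!: realizationsE dest: iso_onD(1) bij_betw_finite)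

text \<open>
  The induced structure is transported to natural numbers along an injection. Only tuples of the
  right arity are transported, which makes the result an \<open>L\<close>-structure whatever \<open>M\<close> is.
\<close>

lemma finite_subset_in_age:
  assumes "finite X" "X \<subseteq> univ M"
  shows "\<exists>A\<in>age ar L M. X \<in> realizations ar L M A"
proof -
  obtain g :: "_ \<Rightarrow> nat" where g: "inj_on g X"
    using finite_imp_inj_to_nat_seg[OF assms(1)] by blast
  define A where "A = \<lparr>univ = g ` X, interp = (\<lambda>S. if S \<in> L
      then map g ` {as \<in> interp M S. length as = ar S \<and> set as \<subseteq> X} else {})\<rparr>"
  have "iso_on ar L g M X A (univ A)"
    unfolding iso_on_def
  proof (intro conjI ballI allI impI)
    show "bij_betw g X (univ A)" using g by (simp add: A_def bij_betw_def)
    fix S as assume S: "S \<in> L" "length as = ar S" "set as \<subseteq> X"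
    have "as = bs" if "map g as = map g bs" "set bs \<subseteq> X" for bs
      using map_inj_on[OF that(1)] g S(3) that(2) by (meson Un_least inj_on_subset)
    then show "as \<in> interp M S \<longleftrightarrow> map g as \<in> interp A S"
      using S by (auto simp: A_def)
  qed
  from iso_on_inv[OF this] have X: "X \<in> realizations ar L M A"
    by (rule realizationsI[OF assms(2)])
  then have "realizations ar L M A \<noteq> {}" by blast
  moreover have "is_rstruct ar L A" "finite (univ A)"
    using assms(1) by (auto simp: is_rstruct_def A_def)
  ultimately have "A \<in> age ar L M" unfolding in_age_iff by blast
  with X show ?thesis by blast
qed

text \<open>
  Arrows are invariant under isomorphism, so each member of the age may be exchanged for a finite
  subset of \<open>M\<close> and conversely.
\<close>

lemma class_RP_age_iff: "class_RP ar L (age ar L M) \<longleftrightarrow> ramsey ar L M"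
proof
  assume rp: "class_RP ar L (age ar L M)"
  show "ramsey ar L M"
    unfolding ramsey_def
  proof (intro allI impI, elim conjE)
    fix X Y k assume X: "finite X" "X \<subseteq> univ M" and Y: "finite Y" "Y \<subseteq> univ M"
    obtain A where A: "A \<in> age ar L M" "X \<in> realizations ar L M A"
      using finite_subset_in_age[OF X] by blast
    obtain B where B: "B \<in> age ar L M" "Y \<in> realizations ar L M B"
      using finite_subset_in_age[OF Y] by blast
    obtain C where C: "C \<in> age ar L M"
      "arrow (max 2 k) (univ C) (realizations ar L C A) (realizations ar L C B)"
      using rp[unfolded class_RP_def, folded arrow_iff_copies, rule_format, OF A(1) B(1), of "max 2 k"]
      by auto
    then obtain Z where Z: "Z \<in> realizations ar L M C" by (auto simp: in_age_iff)
    then obtain f where f: "Z \<subseteq> univ M" "iso_on ar L f C (univ C) M Z"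
      by (rule realizationsE)
    have "arrow (max 2 k) Z (realizations ar L M A) (realizations ar L M B)"
      using arrow_iso[OF f(2) subset_refl f(1) C(2)] .
    then have "arrow k Z (realizations ar L M (induced M X)) (realizations ar L M (induced M Y))"
      unfolding realizations_induced[OF A(2)] realizations_induced[OF B(2)]
      by (rule arrow_fewer_colours) simp
    then show "\<exists>C. finite C \<and> C \<subseteq> univ M \<and>
        arrow k C (realizations ar L M (induced M X)) (realizations ar L M (induced M Y))"
      using f(1) Z C(1) finite_realization[OF Z] by (auto simp: in_age_iff)
  qed
next
  assume ramsey: "ramsey ar L M"
  show "class_RP ar L (age ar L M)"
    unfolding class_RP_def arrow_iff_copies[symmetric]
  proof (intro ballI allI impI)
    fix A B and k :: nat assume A: "A \<in> age ar L M" and B: "B \<in> age ar L M"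
    obtain X where X: "X \<in> realizations ar L M A" using A by (auto simp: in_age_iff)
    obtain Y where Y: "Y \<in> realizations ar L M B" using B by (auto simp: in_age_iff)
    have "finite X" "X \<subseteq> univ M" "finite Y" "Y \<subseteq> univ M"
      using A B X Y finite_realization[OF X] finite_realization[OF Y]
      by (auto simp: in_age_iff realizations_def)
    then obtain Z where Z: "finite Z" "Z \<subseteq> univ M"
      "arrow k Z (realizations ar L M A) (realizations ar L M B)"
      using ramsey[unfolded ramsey_def, rule_format, of X Y k]
      by (auto simp: realizations_induced[OF X] realizations_induced[OF Y])
    obtain C where C: "C \<in> age ar L M" "Z \<in> realizations ar L M C"
      using finite_subset_in_age[OF Z(1,2)] by blast
    obtain f where f: "iso_on ar L f C (univ C) M Z" using C(2) by (rule realizationsE)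
    have "arrow k (univ C) (realizations ar L C A) (realizations ar L C B)"
      using arrow_iso[OF iso_on_inv[OF f] Z(2) subset_refl Z(3)] .
    then show "\<exists>C\<in>age ar L M. arrow k (univ C) (realizations ar L C A) (realizations ar L C B)"
      using C(1) by blast
  qed
qed

section \<open>Several patterns and several coordinates\<close>

lemma arrow_copy:
  assumes "arrow k C (realizations ar L M A) (realizations ar L M B)"
    and "C \<subseteq> univ M" "C' \<in> realizations ar L M (induced M C)"
  shows "arrow k C' (realizations ar L M A) (realizations ar L M B)"
proof -
  obtain f where "C' \<subseteq> univ M" "iso_on ar L f M C M C'"
    using assms(3) by (auto elim: realizationsE simp: iso_on_induced)
  with assms(1,2) show ?thesis by (blast intro: arrow_iso)
qed

lemma ramsey_arrow:
  assumes "ramsey ar L M" "finite (univ A)" "realizations ar L M A \<noteq> {}" "finite D" "D \<subseteq> univ M"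
  obtains C where "finite C" "C \<subseteq> univ M"
    "arrow k C (realizations ar L M A) (realizations ar L M (induced M D))"
proof -
  obtain X where X: "X \<in> realizations ar L M A" using assms(3) by blast
  then have "finite X" "X \<subseteq> univ M"
    using assms(2) finite_realization[OF X] by (auto simp: realizations_def)
  then show ?thesis
    using assms(1)[unfolded ramsey_def, rule_format, of X D k] assms(4,5) that
    unfolding realizations_induced[OF X] by blast
qed

text \<open>
  Several colourings, one for each pattern \<open>P T\<close>, are made constant at once. The induction adds a
  pattern \<open>T\<close> by first taking \<open>C1\<close> that arrows \<open>D\<close> for \<open>P T\<close>, and then \<open>C\<close> that works for \<open>C1\<close> and the
  other patterns: the copy of \<open>C1\<close> found in \<open>C\<close> still arrows \<open>D\<close>.
\<close>

lemma ramsey_patterns: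
  assumes ramsey: "ramsey ar L M" and TT: "finite TT"
    and P: "\<And>T. T \<in> TT \<Longrightarrow> finite (univ (P T)) \<and> realizations ar L M (P T) \<noteq> {}"
    and D: "finite D" "D \<subseteq> univ M"
  shows "\<exists>C. finite C \<and> C \<subseteq> univ M \<and>
    (\<forall>c. (\<forall>T\<in>TT. c T \<in> Pow C \<inter> realizations ar L M (P T) \<rightarrow> {..<k::nat}) \<longrightarrow>
       (\<exists>Y\<in>Pow C \<inter> realizations ar L M (induced M D).
          \<forall>T\<in>TT. \<exists>x. \<forall>X\<in>Pow Y \<inter> realizations ar L M (P T). c T X = x))"
  using TT P D
proof (induction TT arbitrary: D rule: finite_induct)
  case empty
  have "D \<in> Pow D \<inter> realizations ar L M (induced M D)"
    using empty.prems(3) by (simp add: realizations_self)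
  with empty.prems(2,3) show ?case
    by (intro exI[of _ D] conjI) auto
next
  case (insert T TT)
  obtain C1 where C1: "finite C1" "C1 \<subseteq> univ M"
    "arrow k C1 (realizations ar L M (P T)) (realizations ar L M (induced M D))"
    by (rule ramsey_arrow[OF ramsey _ _ insert.prems(2,3), of "P T" k]) (use insert.prems(1) in auto)
  obtain C where C: "finite C" "C \<subseteq> univ M" and
    step: "\<And>c. (\<forall>T\<in>TT. c T \<in> Pow C \<inter> realizations ar L M (P T) \<rightarrow> {..<k}) \<Longrightarrow>
       (\<exists>Y\<in>Pow C \<inter> realizations ar L M (induced M C1).
          \<forall>T\<in>TT. \<exists>x. \<forall>X\<in>Pow Y \<inter> realizations ar L M (P T). c T X = x)"
    using insert.IH[OF _ C1(1,2)] insert.prems(1) by auto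
  have "\<exists>Y\<in>Pow C \<inter> realizations ar L M (induced M D).
          \<forall>S\<in>insert T TT. \<exists>x. \<forall>X\<in>Pow Y \<inter> realizations ar L M (P S). c S X = x"
    if c: "\<forall>S\<in>insert T TT. c S \<in> Pow C \<inter> realizations ar L M (P S) \<rightarrow> {..<k}" for c
  proof -
    obtain Z where Z: "Z \<subseteq> C" "Z \<in> realizations ar L M (induced M C1)"
      and Zc: "\<forall>S\<in>TT. \<exists>x. \<forall>X\<in>Pow Z \<inter> realizations ar L M (P S). c S X = x"
      using step[of c] c by blast
    have "arrow k Z (realizations ar L M (P T)) (realizations ar L M (induced M D))"
      using arrow_copy[OF C1(3,2) Z(2)] .
    moreover have "c T \<in> Pow Z \<inter> realizations ar L M (P T) \<rightarrow> {..<k}"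
    proof (rule subsetD[OF Pi_anti_mono])
      show "Pow Z \<inter> realizations ar L M (P T) \<subseteq> Pow C \<inter> realizations ar L M (P T)"
        using Z(1) by blast
      show "c T \<in> Pow C \<inter> realizations ar L M (P T) \<rightarrow> {..<k}" using c by simp
    qed
    ultimately obtain Y x where Y: "Y \<subseteq> Z" "Y \<in> realizations ar L M (induced M D)"
      and x: "\<And>X. X \<subseteq> Y \<Longrightarrow> X \<in> realizations ar L M (P T) \<Longrightarrow> c T X = x"
      by (rule arrowE) (rule that)
    have "\<exists>x. \<forall>X\<in>Pow Y \<inter> realizations ar L M (P S). c S X = x" if S: "S \<in> insert T TT" for S
    proof (cases "S = T")
      case False
      then have "S \<in> TT" using S by simp
      from bspec[OF Zc this] obtain y where "\<forall>X\<in>Pow Z \<inter> realizations ar L M (P S). c S X = y"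
        by (rule exE)
      then show ?thesis using Y(1) by (intro exI[of _ y]) auto
    qed (use x in auto)
    moreover have "Y \<in> Pow C \<inter> realizations ar L M (induced M D)"
      using Y Z(1) by simp
    ultimately show ?thesis by (intro bexI[of _ Y] ballI)
  qed
  with C show ?case by (intro exI[of _ C] conjI allI impI)
qed

text \<open>
  The product Ramsey theorem, for finitely many colourings at once. In the induction on \<open>J\<close> a
  coordinate \<open>j\<close> is added by fixing \<open>Cj\<close> for the given number of colours; for a pattern \<open>T\<close>, a point
  \<open>Y\<close> of the product over \<open>J\<close> then determines the whole colouring \<open>Z \<mapsto> c T (Y(j := Z))\<close> of the
  copies of \<open>P T j\<close> in \<open>Cj\<close>. There are only finitely many such colourings, so they serve as colours
  for the product over \<open>J\<close>. Once this induced colouring is constant, the colour depends on the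
  coordinate \<open>j\<close> alone, which \<open>Cj\<close> takes care of.
\<close>

lemma product_ramsey:
  assumes J: "finite J" and ramsey: "\<And>j. j \<in> J \<Longrightarrow> ramsey ar L (M j)" and TT: "finite TT"
    and P: "\<And>T j. T \<in> TT \<Longrightarrow> j \<in> J \<Longrightarrow> finite (univ (P T j)) \<and> realizations ar L (M j) (P T j) \<noteq> {}"
    and D: "\<And>j. j \<in> J \<Longrightarrow> finite (D j) \<and> D j \<subseteq> univ (M j)"
    and k: "0 < (k::nat)"
  shows "\<exists>C. (\<forall>j\<in>J. finite (C j) \<and> C j \<subseteq> univ (M j)) \<and>
    (\<forall>c. (\<forall>T\<in>TT. c T \<in> (\<Pi>\<^sub>E j\<in>J. Pow (C j) \<inter> realizations ar L (M j) (P T j)) \<rightarrow> {..<k}) \<longrightarrow>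
       (\<exists>D'. (\<forall>j\<in>J. D' j \<subseteq> C j \<and> D' j \<in> realizations ar L (M j) (induced (M j) (D j))) \<and>
          (\<forall>T\<in>TT. \<exists>x. \<forall>Y\<in>\<Pi>\<^sub>E j\<in>J. Pow (D' j) \<inter> realizations ar L (M j) (P T j). c T Y = x)))"
  using J ramsey P D k
proof (induction J arbitrary: k rule: finite_induct)
  case empty
  then show ?case by auto
next
  case (insert j J)
  define R where "R T i = realizations ar L (M i) (P T i)" for T i
  define copy where "copy i = realizations ar L (M i) (induced (M i) (D i))" for i
  have "\<exists>C. finite C \<and> C \<subseteq> univ (M j) \<and>
    (\<forall>c. (\<forall>T\<in>TT. c T \<in> Pow C \<inter> R T j \<rightarrow> {..<k}) \<longrightarrow>
       (\<exists>Y\<in>Pow C \<inter> copy j. \<forall>T\<in>TT. \<exists>x. \<forall>X\<in>Pow Y \<inter> R T j. c T X = x))"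
    unfolding R_def copy_def by (rule ramsey_patterns) (use insert.prems TT in auto)
  then obtain Cj where Cj: "finite Cj" "Cj \<subseteq> univ (M j)" and
    step: "\<And>c. (\<forall>T\<in>TT. c T \<in> Pow Cj \<inter> R T j \<rightarrow> {..<k}) \<Longrightarrow>
       \<exists>Y\<in>Pow Cj \<inter> copy j. \<forall>T\<in>TT. \<exists>x. \<forall>X\<in>Pow Y \<inter> R T j. c T X = x"
    by blast
  \<comment> \<open>The functions in \<open>W\<close> are the new colours, numbered by \<open>e\<close>.\<close>
  define W where "W = (\<Union>T\<in>TT. (Pow Cj \<inter> R T j) \<rightarrow>\<^sub>E {..<k})"
  have "finite W" using Cj(1) TT by (auto simp: W_def intro!: finite_PiE)
  then obtain e where e: "bij_betw e W {0..<card W}"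
    using ex_bij_betw_finite_nat by blast
  have IH: "\<exists>C. (\<forall>i\<in>J. finite (C i) \<and> C i \<subseteq> univ (M i)) \<and>
    (\<forall>c. (\<forall>T\<in>TT. c T \<in> (\<Pi>\<^sub>E i\<in>J. Pow (C i) \<inter> R T i) \<rightarrow> {..<Suc (card W)}) \<longrightarrow>
       (\<exists>D'. (\<forall>i\<in>J. D' i \<subseteq> C i \<and> D' i \<in> copy i) \<and>
          (\<forall>T\<in>TT. \<exists>x. \<forall>Y\<in>\<Pi>\<^sub>E i\<in>J. Pow (D' i) \<inter> R T i. c T Y = x)))"
    unfolding R_def copy_def by (rule insert.IH) (use insert.prems in auto)
  then obtain C where C: "\<forall>i\<in>J. finite (C i) \<and> C i \<subseteq> univ (M i)" and
    C_step: "\<And>c. (\<forall>T\<in>TT. c T \<in> (\<Pi>\<^sub>E i\<in>J. Pow (C i) \<inter> R T i) \<rightarrow> {..<Suc (card W)}) \<Longrightarrow>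
       \<exists>D'. (\<forall>i\<in>J. D' i \<subseteq> C i \<and> D' i \<in> copy i) \<and>
          (\<forall>T\<in>TT. \<exists>x. \<forall>Y\<in>\<Pi>\<^sub>E i\<in>J. Pow (D' i) \<inter> R T i. c T Y = x)"
    by blast
  let ?C = "C(j := Cj)"
  have upd: "Y(j := Z) \<in> (\<Pi>\<^sub>E i\<in>insert j J. Pow ((B(j := Bj)) i) \<inter> R T i)"
    if "Y \<in> (\<Pi>\<^sub>E i\<in>J. Pow (B i) \<inter> R T i)" "Z \<in> Pow Bj \<inter> R T j" for Y Z T B Bj
    using that insert.hyps(2) by (auto simp: PiE_iff extensional_def)
  have "\<exists>D'. (\<forall>i\<in>insert j J. D' i \<subseteq> ?C i \<and> D' i \<in> copy i) \<and>
          (\<forall>T\<in>TT. \<exists>x. \<forall>Y\<in>\<Pi>\<^sub>E i\<in>insert j J. Pow (D' i) \<inter> R T i. c T Y = x)"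
    if c: "\<forall>T\<in>TT. c T \<in> (\<Pi>\<^sub>E i\<in>insert j J. Pow (?C i) \<inter> R T i) \<rightarrow> {..<k}" for c
  proof -
    define \<phi> where "\<phi> T Y = (\<lambda>Z\<in>Pow Cj \<inter> R T j. c T (Y(j := Z)))" for T Y
    have \<phi>: "\<phi> T Y \<in> W" if "T \<in> TT" "Y \<in> (\<Pi>\<^sub>E i\<in>J. Pow (C i) \<inter> R T i)" for T Y
    proof -
      have "\<phi> T Y \<in> (Pow Cj \<inter> R T j) \<rightarrow>\<^sub>E {..<k}"
        unfolding \<phi>_def restrict_PiE_iff using c that(1) upd[OF that(2)] by blast
      then show ?thesis using that(1) by (auto simp: W_def)
    qed
    have "\<forall>T\<in>TT. (\<lambda>Y. e (\<phi> T Y)) \<in> (\<Pi>\<^sub>E i\<in>J. Pow (C i) \<inter> R T i) \<rightarrow> {..<Suc (card W)}"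
    proof (intro ballI funcsetI)
      fix T Y assume "T \<in> TT" "Y \<in> (\<Pi>\<^sub>E i\<in>J. Pow (C i) \<inter> R T i)"
      from bij_betw_apply[OF e \<phi>[OF this]] show "e (\<phi> T Y) \<in> {..<Suc (card W)}" by simp
    qed
    then have "\<exists>D'. (\<forall>i\<in>J. D' i \<subseteq> C i \<and> D' i \<in> copy i) \<and>
        (\<forall>T\<in>TT. \<exists>x. \<forall>Y\<in>\<Pi>\<^sub>E i\<in>J. Pow (D' i) \<inter> R T i. e (\<phi> T Y) = x)"
      by (rule C_step)
    then obtain D' where *: "(\<forall>i\<in>J. D' i \<subseteq> C i \<and> D' i \<in> copy i) \<and>
        (\<forall>T\<in>TT. \<exists>x. \<forall>Y\<in>\<Pi>\<^sub>E i\<in>J. Pow (D' i) \<inter> R T i. e (\<phi> T Y) = x)"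
      by (rule exE)
    note D' = conjunct1[OF *] and D'c = bspec[OF conjunct2[OF *]]
    define Q where "Q T = (\<Pi>\<^sub>E i\<in>J. Pow (D' i) \<inter> R T i)" for T
    have Q_sub: "Y \<in> (\<Pi>\<^sub>E i\<in>J. Pow (C i) \<inter> R T i)" if "Y \<in> Q T" for Y T
    proof (rule subsetD[OF PiE_mono])
      show "Pow (D' i) \<inter> R T i \<subseteq> Pow (C i) \<inter> R T i" if "i \<in> J" for i
        using bspec[OF D' that] by auto
      show "Y \<in> (\<Pi>\<^sub>E i\<in>J. Pow (D' i) \<inter> R T i)" using that by (simp only: Q_def)
    qed
    have \<phi>_const: "\<phi> T Y = \<phi> T Y'" if T: "T \<in> TT" and Y: "Y \<in> Q T" and Y': "Y' \<in> Q T" for T Y Y'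
    proof (rule inj_onD[OF bij_betw_imp_inj_on[OF e]])
      obtain x where "\<forall>Y\<in>Q T. e (\<phi> T Y) = x" using D'c[OF T] unfolding Q_def by blast
      then show "e (\<phi> T Y) = e (\<phi> T Y')" using Y Y' by simp
      show "\<phi> T Y \<in> W" "\<phi> T Y' \<in> W" using \<phi>[OF T] Q_sub Y Y' by simp_all
    qed
    \<comment> \<open>The colouring at \<open>j\<close> shared by all \<open>Y\<close>; if there is no \<open>Y\<close>, any legal colour will do.\<close>
    define \<psi> where "\<psi> T Z = (if Q T \<noteq> {} then \<phi> T (SOME Y. Y \<in> Q T) Z else 0)" for T Z
    have \<psi>: "\<psi> T Z = c T (Y(j := Z))"
      if T: "T \<in> TT" and Y: "Y \<in> Q T" and Z: "Z \<in> Pow Cj \<inter> R T j" for T Y Z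
    proof -
      have ne: "Q T \<noteq> {}" using Y by blast
      then have "(SOME Y. Y \<in> Q T) \<in> Q T" by (simp add: some_in_eq)
      from \<phi>_const[OF T this Y] have "\<psi> T Z = \<phi> T Y Z"
        using ne by (simp add: \<psi>_def)
      then show ?thesis using Z by (simp add: \<phi>_def)
    qed
    have "\<psi> T Z < k" if T: "T \<in> TT" and Z: "Z \<in> Pow Cj \<inter> R T j" for T Z
    proof (cases "Q T = {}")
      case False
      then obtain Y where Y: "Y \<in> Q T" by blast
      have "c T (Y(j := Z)) \<in> {..<k}" using c T upd[OF Q_sub[OF Y] Z] by blast
      then show ?thesis using \<psi>[OF T Y Z] by simp
    qed (simp add: \<psi>_def insert.prems(4))
    then have "\<forall>T\<in>TT. \<psi> T \<in> Pow Cj \<inter> R T j \<rightarrow> {..<k}" by blast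
    from step[OF this] obtain Dj where Dj: "Dj \<subseteq> Cj" "Dj \<in> copy j"
      and Djc: "\<And>T. T \<in> TT \<Longrightarrow> \<exists>x. \<forall>X\<in>Pow Dj \<inter> R T j. \<psi> T X = x"
      by blast
    have "\<exists>x. \<forall>Y\<in>\<Pi>\<^sub>E i\<in>insert j J. Pow ((D'(j := Dj)) i) \<inter> R T i. c T Y = x" if T: "T \<in> TT" for T
    proof -
      obtain x where x: "\<forall>X\<in>Pow Dj \<inter> R T j. \<psi> T X = x" using Djc[OF T] by blast
      have "c T Y = x" if Y: "Y \<in> (\<Pi>\<^sub>E i\<in>insert j J. Pow ((D'(j := Dj)) i) \<inter> R T i)" for Y
      proof -
        have "Y(j := undefined) \<in> Q T"
          unfolding Q_def using Y insert.hyps(2) by (auto simp: PiE_iff extensional_def split: if_splits)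
        moreover have "Y j \<in> Pow Dj \<inter> R T j" using Y by (auto simp: PiE_iff)
        ultimately show ?thesis using \<psi>[OF T, of "Y(j := undefined)" "Y j"] x Dj(1) by auto
      qed
      then show ?thesis by blast
    qed
    then show ?thesis using D' Dj insert.hyps(2) by (intro exI[of _ "D'(j := Dj)"]) auto
  qed
  then show ?case
    using C Cj insert.hyps(2) unfolding R_def[symmetric] copy_def[symmetric]
    by (intro exI[of _ ?C]) auto
qed

section \<open>Copies in a semidirect product\<close>

text \<open>
  Finite linear orders are rigid: at the least point where \<open>f\<close> and \<open>g\<close> differ, the smaller of the two
  values would be taken by the other map at an earlier point, where the maps agree.
\<close>

lemma ordered_iso_unique:
  assumes M: "ordered_by p M" and M': "ordered_by p M'" and p: "p \<in> L" "ar p = 2"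
    and f: "iso_on ar L f M X M' Y" and g: "iso_on ar L g M X M' Y"
    and X: "finite X" "X \<subseteq> univ M" and Y: "Y \<subseteq> univ M'" and x: "x \<in> X"
  shows "f x = g x"
proof (rule ccontr)
  assume neq: "f x \<noteq> g x"
  let ?r = "\<lambda>a b. [a, b] \<in> interp M p" and ?r' = "\<lambda>a b. [a, b] \<in> interp M' p"
  let ?D = "{x \<in> X. f x \<noteq> g x}"
  have r: "transp ?r" "irreflp ?r" and r': "irreflp ?r'" "totalp_on (univ M') ?r'"
    using M M' unfolding ordered_by_def strict_linear_order_on_def
    by (auto simp: trans_def transp_def irrefl_def irreflp_def total_on_def totalp_on_def)
  have "\<exists>m\<in>?D. \<forall>z\<in>?D. z \<noteq> m \<longrightarrow> \<not> ?r z m"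
  proof (rule Finite_Set.bex_min_element)
    show "asymp_on ?D ?r" 
    proof (rule asymp_onI)
      fix a b assume "?r a b"
      then show "\<not> ?r b a" using transpD[OF r(1), of a b a] irreflpD[OF r(2), of a] by blast
    qed
    show "transp_on ?D ?r" using r(1) by (rule transp_on_subset) simp_all
  qed (use X(1) x neq in auto)
  then obtain m where m: "m \<in> X" "f m \<noteq> g m" and min: "\<And>z. z \<in> X \<Longrightarrow> f z \<noteq> g z \<Longrightarrow> z \<noteq> m \<Longrightarrow> \<not> ?r z m"
    by blast
  have False if f: "iso_on ar L f M X M' Y" and g: "iso_on ar L g M X M' Y"
    and less: "?r' (f m) (g m)" and min: "\<And>z. z \<in> X \<Longrightarrow> f z \<noteq> g z \<Longrightarrow> z \<noteq> m \<Longrightarrow> \<not> ?r z m"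
    for f g
  proof -
    have "f m \<in> g ` X" using iso_onD(3)[OF f] iso_onD(3)[OF g] m(1) by blast
    then obtain z where z: "z \<in> X" "g z = f m" by auto
    have "?r z m"
      using iso_onD(4)[OF g p(1), of "[z, m]"] p(2) z m(1) less by simp
    moreover have "z \<noteq> m" using calculation r(2) by (auto simp: irreflp_def)
    ultimately have "f z = g z" using min z(1) by blast
    then have "z = m" using inj_onD[OF iso_onD(2)[OF f]] z m(1) by simp
    with \<open>z \<noteq> m\<close> show False ..
  qed
  note no_less = this
  have "f m \<in> univ M'" "g m \<in> univ M'"
    using iso_onD(3)[OF f] iso_onD(3)[OF g] m(1) Y by auto
  then have "?r' (f m) (g m) \<or> ?r' (g m) (f m)"
    using r'(2) m(2) by (auto simp: totalp_on_def)
  then show False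
  proof
    assume "?r' (f m) (g m)"
    then show False using no_less[OF f g] min by blast
  next
    assume "?r' (g m) (f m)"
    then show False using no_less[OF g f] min by (metis (no_types))
  qed
qed

text \<open>
  The description of copies in the product uses equality of the ages of the \<open>M i\<close> only through
  nullary symbols: a nonempty tuple belongs to at most one \<open>M i\<close>, but the empty tuple is a tuple of
  each of them, and without agreement the union that interprets a symbol of \<open>L1\<close> would not restrict
  to its interpretation in \<open>M i\<close>.
\<close>

locale semidirect_family =
  fixes ar :: "'s \<Rightarrow> nat" and L1 L2 :: "'s set" and p E :: 's
    and N :: "('i, 's) rstruct" and M :: "'i \<Rightarrow> ('a, 's) rstruct"
  assumes L12: "L1 \<inter> L2 = {p}" and arp: "ar p = 2" and E: "E \<notin> L1 \<union> L2" and arE: "ar E = 2"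
    and N_ordered: "ordered_by p N"
    and M_struct: "\<And>i. i \<in> univ N \<Longrightarrow> is_rstruct ar L1 (M i)"
    and disjoint: "disjoint_family_on (\<lambda>i. univ (M i)) (univ N)"
    and nullary: "\<And>i j S. i \<in> univ N \<Longrightarrow> j \<in> univ N \<Longrightarrow> S \<in> L1 \<Longrightarrow> ar S = 0 \<Longrightarrow>
      [] \<in> interp (M i) S \<longleftrightarrow> [] \<in> interp (M j) S"
begin

abbreviation "L \<equiv> L1 \<union> L2 \<union> {E}"
abbreviation "I \<equiv> semidirect ar L1 L2 p E N M"

definition idx :: "'a \<Rightarrow> 'i" where
  "idx a = (THE i. i \<in> univ N \<and> a \<in> univ (M i))"

lemma p_in: "p \<in> L1" "p \<in> L2" using L12 by auto

lemma p_neq_E: "p \<noteq> E" using p_in E by blast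

lemma univ_I: "univ I = (\<Union>i\<in>univ N. univ (M i))"
  by (simp add: semidirect_def)

lemma idx_eq: assumes "i \<in> univ N" "a \<in> univ (M i)" shows "idx a = i"
  unfolding idx_def
proof (rule the_equality)
  fix j assume "j \<in> univ N \<and> a \<in> univ (M j)"
  then show "j = i" using assms disjoint by (auto simp: disjoint_family_on_def)
qed (use assms in simp)

lemma idx_in: assumes "a \<in> univ I" shows "idx a \<in> univ N" "a \<in> univ (M (idx a))"
  using assms idx_eq by (auto simp: univ_I)

lemma in_fibre_iff: assumes "a \<in> univ I" "i \<in> univ N" shows "a \<in> univ (M i) \<longleftrightarrow> idx a = i"
  using idx_eq[OF assms(2)] idx_in[OF assms(1)] by auto

lemma fibre_eq: "A \<subseteq> univ I \<Longrightarrow> l \<in> univ N \<Longrightarrow> A \<inter> univ (M l) = {a \<in> A. idx a = l}"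
  using in_fibre_iff by auto

lemma idx_image: "A \<subseteq> univ I \<Longrightarrow> idx ` A \<subseteq> univ N"
  using idx_in(1) by auto

lemma N_irrefl: "[i, i] \<notin> interp N p"
  using N_ordered by (auto simp: ordered_by_def strict_linear_order_on_def irrefl_def)

lemma interp_p:
  assumes "a \<in> univ I" "b \<in> univ I"
  shows "[a, b] \<in> interp I p \<longleftrightarrow>
    [idx a, idx b] \<in> interp N p \<or> idx a = idx b \<and> [a, b] \<in> interp (M (idx a)) p"
proof -
  have "[a, b] \<in> interp I p \<longleftrightarrow> (\<exists>i\<in>univ N. \<exists>j\<in>univ N. a \<in> univ (M i) \<and> b \<in> univ (M j) \<and>
             ([i, j] \<in> interp N p \<or> i = j \<and> [a, b] \<in> interp (M i) p))"
    by (simp add: semidirect_def)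
  also have "\<dots> \<longleftrightarrow> (\<exists>i\<in>univ N. \<exists>j\<in>univ N. idx a = i \<and> idx b = j \<and>
             ([i, j] \<in> interp N p \<or> i = j \<and> [a, b] \<in> interp (M i) p))"
    by (simp add: in_fibre_iff assms cong: bex_cong)
  finally show ?thesis using idx_in[OF assms(1)] idx_in[OF assms(2)] by auto
qed

lemma interp_E:
  assumes "a \<in> univ I" "b \<in> univ I"
  shows "[a, b] \<in> interp I E \<longleftrightarrow> idx a = idx b"
proof -
  have "[a, b] \<in> interp I E \<longleftrightarrow> (\<exists>i\<in>univ N. a \<in> univ (M i) \<and> b \<in> univ (M i))"
    using p_neq_E by (simp add: semidirect_def)
  also have "\<dots> \<longleftrightarrow> (\<exists>i\<in>univ N. idx a = i \<and> idx b = i)"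
    by (simp add: in_fibre_iff assms cong: bex_cong)
  finally show ?thesis using idx_in[OF assms(1)] by auto
qed

lemma interp_L1:
  assumes "S \<in> L1" "S \<noteq> p"
  shows "as \<in> interp I S \<longleftrightarrow> (\<exists>i\<in>univ N. as \<in> interp (M i) S)"
  using assms E by (auto simp: semidirect_def)

lemma interp_L2:
  assumes S: "S \<in> L2" "S \<noteq> p" and as: "length as = ar S" "set as \<subseteq> univ I"
  shows "as \<in> interp I S \<longleftrightarrow> map idx as \<in> interp N S"
proof -
  have "S \<notin> L1" "S \<noteq> E" using S L12 E by auto
  then have eq: "as \<in> interp I S \<longleftrightarrow> (\<exists>ts. length ts = ar S \<and> set ts \<subseteq> univ N \<and>
                (\<forall>k<ar S. as ! k \<in> univ (M (ts ! k))) \<and> ts \<in> interp N S)"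
    using S as(1) by (simp add: semidirect_def)
  have "ts = map idx as" if "length ts = ar S" "set ts \<subseteq> univ N" "\<forall>k<ar S. as ! k \<in> univ (M (ts ! k))" for ts
    using that as(1) by (intro nth_equalityI) (auto intro!: idx_eq[symmetric])
  moreover have "set (map idx as) \<subseteq> univ N" "\<forall>k<ar S. as ! k \<in> univ (M (map idx as ! k))"
    using as idx_in by (auto simp: subset_iff)
  ultimately show ?thesis unfolding eq using as(1) by (metis length_map)
qed

lemma interp_M_subset:
  assumes "i \<in> univ N" "S \<in> L1" "as \<in> interp (M i) S"
  shows "set as \<subseteq> univ (M i)"
  using M_struct[OF assms(1)] assms(2,3) unfolding is_rstruct_def by blast

text \<open>
  Each \<open>M i\<close> sits in the product as an induced \<open>L1\<close>-substructure. For \<open>p\<close> this uses that the order of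
  \<open>N\<close> is irreflexive.
\<close>

lemma interp_fibre:
  assumes i: "i \<in> univ N" and S: "S \<in> L1" and as: "length as = ar S" "set as \<subseteq> univ (M i)"
  shows "as \<in> interp I S \<longleftrightarrow> as \<in> interp (M i) S"
proof (cases "S = p")
  case True
  then obtain a b where ab: "as = [a, b]"
    using as(1) arp by (auto simp: length_Suc_conv numeral_2_eq_2)
  then have "idx a = i" "idx b = i" "a \<in> univ I" "b \<in> univ I"
    using as(2) i idx_eq by (auto simp: univ_I)
  then show ?thesis using True ab N_irrefl by (simp add: interp_p)
next
  case False
  have "as \<in> interp (M i) S" if j: "j \<in> univ N" "as \<in> interp (M j) S" for j
  proof (cases as)
    case Nil
    then show ?thesis using nullary[OF i j(1) S] as(1) j(2) by simp
  next
    case (Cons a bs)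
    then have "a \<in> univ (M j)" "a \<in> univ (M i)"
      using as(2) interp_M_subset[OF j(1) S j(2)] by auto
    then have "i = j" using i j(1) idx_eq by metis
    then show ?thesis using j(2) by simp
  qed
  then show ?thesis using interp_L1[OF S False] i by blast
qed

lemma interp_L1_same_fibre:
  assumes "S \<in> L1" "S \<noteq> p" "as \<in> interp I S" "a \<in> set as" "b \<in> set as"
  shows "idx a = idx b"
proof -
  obtain i where i: "i \<in> univ N" "as \<in> interp (M i) S" using assms(1-3) interp_L1 by blast
  then have "set as \<subseteq> univ (M i)" by (rule interp_M_subset[OF _ assms(1)])
  then have "idx a = i" "idx b = i" using idx_eq[OF i(1)] assms(4,5) by blast+
  then show ?thesis by simp
qed

text \<open>
  An isomorphism \<open>g\<close> from \<open>A\<close> to \<open>A'\<close> preserves \<open>E\<close>, so it maps fibres onto fibres and induces a map \<open>f\<close> on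
  indices; \<open>f\<close> is an \<open>L2\<close>-isomorphism because tuples of indices lift to tuples of \<open>A\<close>, and \<open>g\<close> restricts
  to an \<open>L1\<close>-isomorphism on each fibre.
\<close>

lemma copy_decomposes:
  assumes A: "A \<subseteq> univ I" and A': "A' \<in> realizations ar L I (induced I A)"
  obtains f where "iso_on ar L2 f N (idx ` A) N (idx ` A')"
    and "\<And>l. l \<in> idx ` A \<Longrightarrow>
      A' \<inter> univ (M (f l)) \<in> realizations ar L1 (M (f l)) (induced (M l) (A \<inter> univ (M l)))"
proof -
  obtain g where A'I: "A' \<subseteq> univ I" and g: "iso_on ar L g I A I A'"
    using A' by (auto simp: realizations_induced_iff)
  have gA: "g ` A = A'" and g_in: "\<And>a. a \<in> A \<Longrightarrow> g a \<in> univ I"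
    using iso_onD(3)[OF g] A'I by auto
  note gS = iso_onD(4)[OF g]
  have same: "idx a = idx b \<longleftrightarrow> idx (g a) = idx (g b)" if "a \<in> A" "b \<in> A" for a b
    using gS[of E "[a, b]"] that A arE g_in by (auto simp: interp_E subset_iff)
  define rep where "rep = inv_into A idx"
  define f where "f l = idx (g (rep l))" for l
  have rep: "rep l \<in> A" "idx (rep l) = l" if "l \<in> idx ` A" for l
    unfolding rep_def using that by (rule inv_into_into, rule f_inv_into_f)
  have f_idx: "f (idx a) = idx (g a)" if "a \<in> A" for a
    unfolding f_def using same[of "rep (idx a)" a] rep[of "idx a"] that by simp
  have "iso_on ar L2 f N (idx ` A) N (idx ` A')"
    unfolding iso_on_def
  proof (intro conjI ballI allI impI)
    show "bij_betw f (idx ` A) (idx ` A')"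
      unfolding bij_betw_def
    proof
      show "inj_on f (idx ` A)" by (rule inj_onI) (auto simp: f_idx same)
      show "f ` idx ` A = idx ` A'" unfolding gA[symmetric] image_image
        by (rule image_cong) (auto simp: f_idx)
    qed
    fix S ts assume S: "S \<in> L2" and ts: "length ts = ar S" "set ts \<subseteq> idx ` A"
    \<comment> \<open>Lift the tuple of indices to a tuple of elements.\<close>
    define as where "as = map rep ts"
    have as: "map idx as = ts" "set as \<subseteq> A" "length as = ar S"
      unfolding as_def using rep ts by (auto simp: subset_iff map_idI)
    have f_as: "map f ts = map idx (map g as)" by (simp add: as_def f_def)
    have as_iff: "as \<in> interp I S \<longleftrightarrow> map g as \<in> interp I S"
      using gS[of S as] S as by simp
    show "ts \<in> interp N S \<longleftrightarrow> map f ts \<in> interp N S"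
    proof (cases "S = p")
      case True
      then obtain a b where ab: "as = [a, b]"
        using as(3) arp by (auto simp: length_Suc_conv numeral_2_eq_2)
      have "a \<in> A" "b \<in> A" using ab as(2) by auto
      then have "a \<in> univ I" "b \<in> univ I" "g a \<in> univ I" "g b \<in> univ I" "idx a = idx b \<longleftrightarrow> idx (g a) = idx (g b)"
        using A g_in same by blast+
      then show ?thesis
        using as_iff f_as ab as(1) True N_irrefl by (cases "idx a = idx b") (auto simp: interp_p)
    next
      case False
      have "set as \<subseteq> univ I" "set (map g as) \<subseteq> univ I" using as(2) A g_in by auto
      then show ?thesis
        using interp_L2[OF S False as(3)] interp_L2[OF S False, of "map g as"] as_iff as(1,3) f_as by simp
    qed
  qed
  moreover have "A' \<inter> univ (M (f l)) \<in> realizations ar L1 (M (f l)) (induced (M l) (A \<inter> univ (M l)))"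
    if l: "l \<in> idx ` A" for l
  proof -
    have lN: "l \<in> univ N" using l idx_image[OF A] by blast
    have flN: "f l \<in> univ N" using l g_in idx_in by (auto simp: f_idx)
    have fib: "A \<inter> univ (M l) = {a \<in> A. idx a = l}" by (rule fibre_eq[OF A lN])
    have fib': "A' \<inter> univ (M (f l)) = {a \<in> A'. idx a = f l}" by (rule fibre_eq[OF A'I flN])
    have img: "g ` (A \<inter> univ (M l)) = A' \<inter> univ (M (f l))"
      unfolding fib fib' unfolding gA[symmetric] using l by (auto simp: f_idx same)
    have "iso_on ar L1 g (M l) (A \<inter> univ (M l)) (M (f l)) (A' \<inter> univ (M (f l)))"
      unfolding iso_on_def
    proof (intro conjI ballI allI impI)
      show "bij_betw g (A \<inter> univ (M l)) (A' \<inter> univ (M (f l)))"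
        using iso_onD(2)[OF g] img by (auto simp: bij_betw_def intro: inj_on_subset)
      fix S as assume S: "S \<in> L1" and as: "length as = ar S" "set as \<subseteq> A \<inter> univ (M l)"
      have "set (map g as) \<subseteq> univ (M (f l))" using as(2) img by auto
      then show "as \<in> interp (M l) S \<longleftrightarrow> map g as \<in> interp (M (f l)) S"
        using interp_fibre[OF lN S as(1)] interp_fibre[OF flN S, of "map g as"] gS[of S as] S as by auto
    qed
    then show ?thesis by (auto simp: realizations_induced_iff)
  qed
  ultimately show ?thesis by (rule that)
qed

text \<open>
  Conversely, isomorphisms of the fibres over an isomorphism \<open>f\<close> of the index sets combine to an
  isomorphism. A tuple that meets two fibres satisfies no relation of \<open>L1\<close> other than the order, and
  a tuple in one fibre is handled by the isomorphism of that fibre.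
\<close>

lemma copies_glue:
  assumes A: "A \<subseteq> univ I" and T: "T \<subseteq> univ N" and f: "iso_on ar L2 f N (idx ` A) N T"
    and Y: "\<And>l. l \<in> idx ` A \<Longrightarrow>
      Y (f l) \<in> realizations ar L1 (M (f l)) (induced (M l) (A \<inter> univ (M l)))"
  shows "(\<Union>j\<in>T. Y j) \<in> realizations ar L I (induced I A)"
proof -
  have "\<exists>h. Y (f l) \<subseteq> univ (M (f l)) \<and> iso_on ar L1 h (M l) (A \<inter> univ (M l)) (M (f l)) (Y (f l))"
    if "l \<in> idx ` A" for l
    using Y[OF that] by (simp add: realizations_induced_iff)
  then obtain h where h: "\<And>l. l \<in> idx ` A \<Longrightarrow> Y (f l) \<subseteq> univ (M (f l)) \<and>
      iso_on ar L1 (h l) (M l) (A \<inter> univ (M l)) (M (f l)) (Y (f l))"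
    by metis
  define g where "g a = h (idx a) a" for a
  have fT: "f ` idx ` A = T" using iso_onD(3)[OF f] .
  have fib: "A \<inter> univ (M l) = {a \<in> A. idx a = l}" if "l \<in> idx ` A" for l
    using fibre_eq[OF A] idx_image[OF A] that by blast
  have h_img: "h l ` {a \<in> A. idx a = l} = Y (f l)" if "l \<in> idx ` A" for l
    using iso_onD(3)[OF conjunct2[OF h[OF that]]] fib[OF that] by simp
  have flN: "f l \<in> univ N" if "l \<in> idx ` A" for l using that fT T by blast
  have g_Y: "g a \<in> Y (f (idx a))" if "a \<in> A" for a
    using h_img[of "idx a"] that by (auto simp: g_def)
  then have g_M: "g a \<in> univ (M (f (idx a)))" if "a \<in> A" for a
    using h[of "idx a"] that by auto
  then have g_in: "g a \<in> univ I" and idx_g: "idx (g a) = f (idx a)" if "a \<in> A" for a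
    using flN[of "idx a"] that idx_eq by (auto simp: univ_I)
  have f_inj: "f (idx a) = f (idx b) \<longleftrightarrow> idx a = idx b" if "a \<in> A" "b \<in> A" for a b
    using inj_on_eq_iff[OF iso_onD(2)[OF f]] that by blast
  have "iso_on ar L g I A I (\<Union>j\<in>T. Y j)"
    unfolding iso_on_def
  proof (intro conjI ballI allI impI)
    show "bij_betw g A (\<Union>j\<in>T. Y j)"
      unfolding bij_betw_def
    proof
      show "inj_on g A"
      proof (rule inj_onI)
        fix a b assume ab: "a \<in> A" "b \<in> A" "g a = g b"
        then have eq: "idx a = idx b" using idx_g[of a] idx_g[of b] f_inj[of a b] by simp
        have l: "idx a \<in> idx ` A" using ab(1) by blast
        have "inj_on (h (idx a)) {a' \<in> A. idx a' = idx a}"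
          using iso_onD(2)[OF conjunct2[OF h[OF l]]] fib[OF l] by simp
        then show "a = b" by (rule inj_onD) (use ab eq in \<open>simp_all add: g_def\<close>)
      qed
      have "g ` A = (\<Union>l\<in>idx ` A. g ` {a \<in> A. idx a = l})" by auto
      also have "\<dots> = (\<Union>l\<in>idx ` A. Y (f l))"
        by (rule SUP_cong) (auto simp: g_def h_img[symmetric])
      finally show "g ` A = (\<Union>j\<in>T. Y j)" unfolding fT[symmetric] by auto
    qed
    fix S as assume S: "S \<in> L" and as: "length as = ar S" "set as \<subseteq> A"
    have asI: "set as \<subseteq> univ I" "set (map g as) \<subseteq> univ I" using as(2) A g_in by auto
    have idx_map: "map idx (map g as) = map f (map idx as)" using as(2) idx_g by auto
    define one_fibre where "one_fibre \<longleftrightarrow> (\<forall>a\<in>set as. \<forall>b\<in>set as. idx a = idx b)"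
    consider "S = E" | "S \<in> L1" one_fibre "as \<noteq> []" | "as = []"
      | "S \<in> L1" "S \<noteq> p" "\<not> one_fibre" | "S = p" "\<not> one_fibre" | "S \<in> L2" "S \<noteq> p"
      using S p_in by blast
    then show "as \<in> interp I S \<longleftrightarrow> map g as \<in> interp I S"
    proof cases
      case 1
      then obtain a b where "as = [a, b]"
        using as(1) arE by (auto simp: length_Suc_conv numeral_2_eq_2)
      then show ?thesis using 1 asI as(2) by (simp add: interp_E idx_g f_inj)
    next
      case 2
      define l where "l = idx (hd as)"
      have l: "l \<in> idx ` A" using hd_in_set[OF 2(3)] as(2) unfolding l_def by blast
      have all: "idx a = l" if "a \<in> set as" for a
        using 2(2) that hd_in_set[OF 2(3)] unfolding l_def one_fibre_def by blast
      have lN: "l \<in> univ N" using l idx_image[OF A] by blast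
      have g_h: "map g as = map (h l) as" using all by (auto simp: g_def)
      have "set as \<subseteq> A \<inter> univ (M l)" using all as(2) fib[OF l] by auto
      moreover have "set (map g as) \<subseteq> univ (M (f l))" using all as(2) g_M by auto
      ultimately show ?thesis
        using interp_fibre[OF lN 2(1) as(1)] interp_fibre[OF flN[OF l] 2(1), of "map g as"]
          iso_onD(4)[OF conjunct2[OF h[OF l]] 2(1) as(1)] as(1) by (simp add: g_h)
    next
      case 3
      then show ?thesis by simp
    next
      case 4
      then obtain a b where ab: "a \<in> set as" "b \<in> set as" "idx a \<noteq> idx b" unfolding one_fibre_def by blast
      then have "idx (g a) \<noteq> idx (g b)" using as(2) by (auto simp: idx_g f_inj subset_iff)
      moreover have "g a \<in> set (map g as)" "g b \<in> set (map g as)" using ab by auto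
      ultimately show ?thesis
        using interp_L1_same_fibre[OF 4(1,2)] ab by blast
    next
      case 5
      then obtain a b where ab: "as = [a, b]"
        using as(1) arp by (auto simp: length_Suc_conv numeral_2_eq_2)
      then have neq: "idx a \<noteq> idx b" using 5(2) by (auto simp: one_fibre_def)
      have "[idx a, idx b] \<in> interp N p \<longleftrightarrow> [f (idx a), f (idx b)] \<in> interp N p"
        using iso_onD(4)[OF f p_in(2), of "[idx a, idx b]"] ab as(2) arp by simp
      then show ?thesis using 5(1) ab asI as(2) neq by (simp add: interp_p idx_g f_inj)
    next
      case 6
      have "map idx as \<in> interp N S \<longleftrightarrow> map f (map idx as) \<in> interp N S"
        using iso_onD(4)[OF f 6(1), of "map idx as"] as by auto
      then show ?thesis
        using interp_L2[OF 6 as(1) asI(1)] interp_L2[OF 6 _ asI(2)] as(1)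
        unfolding idx_map by (simp only: length_map simp_thms)
    qed
  qed
  moreover have "(\<Union>j\<in>T. Y j) \<subseteq> univ I"
    using h T unfolding fT[symmetric] univ_I by fastforce
  ultimately show ?thesis by (auto simp: realizations_induced_iff)
qed

end

section \<open>The Ramsey property of the semidirect product\<close>

context semidirect_family
begin

text \<open>
  The combination of the Ramsey properties of \<open>N\<close> and of the \<open>M i\<close>: first \<open>CN\<close> is chosen for the index
  sets of \<open>A\<close> and \<open>B\<close>, then the fibres over \<open>CN\<close> by \<open>product_ramsey\<close>, with one pattern for each copy
  \<open>T\<close> of the index set of \<open>A\<close> in \<open>CN\<close>.
\<close>

theorem ramsey_semidirect:
  assumes ramsey_N: "ramsey ar L2 N" and ramsey_M: "\<And>i. i \<in> univ N \<Longrightarrow> ramsey ar L1 (M i)"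
    and same_age: "\<And>i j X. i \<in> univ N \<Longrightarrow> j \<in> univ N \<Longrightarrow> finite X \<Longrightarrow> X \<subseteq> univ (M i) \<Longrightarrow>
      realizations ar L1 (M j) (induced (M i) X) \<noteq> {}"
  shows "ramsey ar L I"
  unfolding ramsey_def
proof (intro allI impI, elim conjE)
  fix A B and k :: nat
  assume finA: "finite A" and A: "A \<subseteq> univ I" and finB: "finite B" and B: "B \<subseteq> univ I"
  define AN where "AN = idx ` A"
  define BN where "BN = idx ` B"
  have AN: "finite AN" "AN \<subseteq> univ N" and BN: "finite BN" "BN \<subseteq> univ N"
    using finA finB idx_image[OF A] idx_image[OF B] by (auto simp: AN_def BN_def)
  define A_copies where "A_copies = realizations ar L I (induced I A)"
  define AN_copies where "AN_copies = realizations ar L2 N (induced N AN)"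
  obtain CN where CN: "finite CN" "CN \<subseteq> univ N"
    and arrow_N: "arrow (Suc k) CN AN_copies (realizations ar L2 N (induced N BN))"
    using ramsey_N[unfolded ramsey_def, rule_format, of AN BN "Suc k"] AN BN
    unfolding AN_copies_def by blast
  define TT where "TT = Pow CN \<inter> AN_copies"
  have finTT: "finite TT" using CN(1) by (simp add: TT_def)
  have "\<exists>f. iso_on ar L2 f N AN N T" if "T \<in> TT" for T
    using that by (simp add: TT_def AN_copies_def realizations_induced_iff)
  then obtain f where f: "\<And>T. T \<in> TT \<Longrightarrow> iso_on ar L2 (f T) N AN N T"
    by metis
  define pre where "pre T j = inv_into AN (f T) j" for T j
  have pre_f: "pre T (f T l) = l" if "T \<in> TT" "l \<in> AN" for T l
    unfolding pre_def using iso_onD(2)[OF f[OF that(1)]] that(2) by (rule inv_into_f_f)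
  \<comment> \<open>The fibre over \<open>j\<close> of a copy of \<open>A\<close> with index set \<open>T\<close>; it is empty for \<open>j\<close> outside \<open>T\<close>.\<close>
  define P where "P T j = (if j \<in> T then induced (M (pre T j)) (A \<inter> univ (M (pre T j)))
    else induced (M j) {})" for T j
  have P: "finite (univ (P T j)) \<and> realizations ar L1 (M j) (P T j) \<noteq> {}"
    if T: "T \<in> TT" and j: "j \<in> CN" for T j
  proof (cases "j \<in> T")
    case True
    then obtain l where l: "l \<in> AN" "j = f T l" using iso_onD(3)[OF f[OF T]] by blast
    then have "realizations ar L1 (M j) (induced (M l) (A \<inter> univ (M l))) \<noteq> {}"
      using AN(2) CN(2) j finA by (intro same_age) auto
    then show ?thesis using True l pre_f[OF T l(1)] finA by (simp add: P_def)
  next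
    case False
    then show ?thesis using realizations_self[of "{}" "M j"] by (auto simp: P_def)
  qed
  \<comment> \<open>Any fibre of \<open>B\<close> may have to be found over any index \<open>j\<close>, so \<open>D j\<close> contains a copy of each.\<close>
  define R where "R i j = (SOME Z. Z \<in> realizations ar L1 (M j) (induced (M i) (B \<inter> univ (M i))))" for i j
  have R: "R i j \<in> realizations ar L1 (M j) (induced (M i) (B \<inter> univ (M i)))"
    if "i \<in> BN" "j \<in> CN" for i j
    unfolding R_def some_in_eq using that BN(2) CN(2) finB by (intro same_age) auto
  have finR: "finite (R i j)" if "i \<in> BN" "j \<in> CN" for i j
    using finite_realization[OF R[OF that]] finB by simp
  define D where "D j = (\<Union>i\<in>BN. R i j)" for j
  have D: "finite (D j) \<and> D j \<subseteq> univ (M j)" if "j \<in> CN" for j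
    using BN(1) finR R that unfolding D_def realizations_def by blast
  define G where "G C T = (\<Pi>\<^sub>E j\<in>CN. Pow (C j) \<inter> realizations ar L1 (M j) (P T j))" for C T
  have "\<exists>C. (\<forall>j\<in>CN. finite (C j) \<and> C j \<subseteq> univ (M j)) \<and>
    (\<forall>c. (\<forall>T\<in>TT. c T \<in> G C T \<rightarrow> {..<Suc k}) \<longrightarrow>
       (\<exists>D'. (\<forall>j\<in>CN. D' j \<subseteq> C j \<and> D' j \<in> realizations ar L1 (M j) (induced (M j) (D j))) \<and>
          (\<forall>T\<in>TT. \<exists>x. \<forall>Y\<in>G D' T. c T Y = x)))"
    unfolding G_def by (rule product_ramsey) (use CN ramsey_M finTT P D in auto)
  then obtain C where C_all: "\<forall>j\<in>CN. finite (C j) \<and> C j \<subseteq> univ (M j)"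
    and C_step: "\<forall>c. (\<forall>T\<in>TT. c T \<in> G C T \<rightarrow> {..<Suc k}) \<longrightarrow>
       (\<exists>D'. (\<forall>j\<in>CN. D' j \<subseteq> C j \<and> D' j \<in> realizations ar L1 (M j) (induced (M j) (D j))) \<and>
          (\<forall>T\<in>TT. \<exists>x. \<forall>Y\<in>G D' T. c T Y = x))"
    by (elim exE conjE)
  note C = bspec[OF C_all]
  define U where "U Y = (\<Union>j\<in>CN. Y j)" for Y :: "'i \<Rightarrow> 'a set"
  have UC_I: "U C \<subseteq> univ I" unfolding U_def univ_I using C CN(2) by blast
  have idx_C: "idx a = j" if "a \<in> C j" "j \<in> CN" for a j
    using that C CN(2) by (intro idx_eq) auto
  have glue: "U Y \<in> A_copies" if T: "T \<in> TT" and Y: "Y \<in> G C T" for T Y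
  proof -
    have T_sub: "T \<subseteq> CN" using T by (simp add: TT_def)
    have Yj: "Y j \<in> realizations ar L1 (M j) (P T j)" if "j \<in> CN" for j
      using Y that by (auto simp: G_def)
    have "Y j = {}" if "j \<in> CN" "j \<notin> T" for j
      using Yj[OF that(1)] that(2) by (intro realizations_empty) (simp add: P_def)
    then have "U Y = (\<Union>j\<in>T. Y j)" using T_sub by (auto simp: U_def)
    moreover have "(\<Union>j\<in>T. Y j) \<in> A_copies"
      unfolding A_copies_def
    proof (rule copies_glue[OF A])
      show "T \<subseteq> univ N" using T_sub CN(2) by blast
      show "iso_on ar L2 (f T) N (idx ` A) N T" using f[OF T] by (simp add: AN_def)
      fix l assume l: "l \<in> idx ` A"
      then have lAN: "l \<in> AN" by (simp add: AN_def)
      then have fl: "f T l \<in> T" using iso_onD(3)[OF f[OF T]] by blast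
      then show "Y (f T l) \<in> realizations ar L1 (M (f T l)) (induced (M l) (A \<inter> univ (M l)))"
        using Yj[of "f T l"] T_sub pre_f[OF T lAN] by (auto simp: P_def)
    qed
    ultimately show ?thesis by simp
  qed
  have decompose: "idx ` A' \<in> TT"
    "\<And>j. j \<in> CN \<Longrightarrow> A' \<inter> univ (M j) \<in> realizations ar L1 (M j) (P (idx ` A') j)"
    if A': "A' \<in> A_copies" "A' \<subseteq> U C" for A'
  proof -
    obtain f' where f': "iso_on ar L2 f' N AN N (idx ` A')"
      and fib: "\<And>l. l \<in> AN \<Longrightarrow>
        A' \<inter> univ (M (f' l)) \<in> realizations ar L1 (M (f' l)) (induced (M l) (A \<inter> univ (M l)))"
      using A'(1) copy_decomposes[OF A, of A'] unfolding A_copies_def AN_def by blast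
    have sub: "idx ` A' \<subseteq> CN" using A'(2) idx_C by (auto simp: U_def)
    show T: "idx ` A' \<in> TT"
      using f' sub CN(2) by (auto simp: TT_def AN_copies_def realizations_induced_iff)
    fix j assume j: "j \<in> CN"
    show "A' \<inter> univ (M j) \<in> realizations ar L1 (M j) (P (idx ` A') j)"
    proof (cases "j \<in> idx ` A'")
      case True
      then obtain l where l: "l \<in> AN" "j = f' l" using iso_onD(3)[OF f'] by blast
      \<comment> \<open>By rigidity, the index map of \<open>A'\<close> is the one that was fixed to define the pattern.\<close>
      have "f' l = f (idx ` A') l"
        using ordered_iso_unique[OF N_ordered N_ordered p_in(2) arp f' f[OF T] AN] sub CN(2) l(1)
        by blast
      then have "pre (idx ` A') j = l" using pre_f[OF T l(1)] l(2) by simp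
      then show ?thesis using fib[OF l(1)] True l(2) by (simp add: P_def)
    next
      case False
      have "A' \<inter> univ (M j) = {}" using idx_eq[of j] j CN(2) False by blast
      then show ?thesis using False realizations_self[of "{}" "M j"] by (simp add: P_def)
    qed
  qed
  have "arrow (Suc k) (U C) A_copies (realizations ar L I (induced I B))"
    unfolding arrow_def
  proof (intro allI impI)
    fix c assume c: "c \<in> Pow (U C) \<inter> A_copies \<rightarrow> {..<Suc k}"
    have cU: "c (U Y) < Suc k" if "T \<in> TT" "Y \<in> G C T" for T Y
    proof -
      have "U Y \<subseteq> U C" using that(2) by (auto simp: U_def G_def)
      then show ?thesis using c glue[OF that] by auto
    qed
    then have "\<forall>T\<in>TT. (\<lambda>Y. c (U Y)) \<in> G C T \<rightarrow> {..<Suc k}" by auto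
    then have "\<exists>D'. (\<forall>j\<in>CN. D' j \<subseteq> C j \<and> D' j \<in> realizations ar L1 (M j) (induced (M j) (D j))) \<and>
          (\<forall>T\<in>TT. \<exists>x. \<forall>Y\<in>G D' T. c (U Y) = x)"
      using C_step[THEN spec, of "\<lambda>_ Y. c (U Y)"] by (simp only: simp_thms)
    then obtain D' where
      D'_all: "\<forall>j\<in>CN. D' j \<subseteq> C j \<and> D' j \<in> realizations ar L1 (M j) (induced (M j) (D j))"
      and D'_const: "\<forall>T\<in>TT. \<exists>x. \<forall>Y\<in>G D' T. c (U Y) = x"
      by (elim exE conjE)
    have D'_C: "D' j \<subseteq> C j"
      and D': "D' j \<in> realizations ar L1 (M j) (induced (M j) (D j))" if "j \<in> CN" for j
      using bspec[OF D'_all that] by simp_all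
    have G_sub: "Y \<in> G C T" if "Y \<in> G D' T" for Y T
    proof -
      have "G D' T \<subseteq> G C T" unfolding G_def by (rule PiE_mono) (use D'_C in blast)
      then show ?thesis using that by blast
    qed
    \<comment> \<open>The copies of \<open>A\<close> over \<open>T\<close> inside \<open>D'\<close> have one colour, which colours \<open>T\<close> itself; without such copies, \<open>T\<close> gets an arbitrary legal colour.\<close>
    define \<chi> where "\<chi> T = (if G D' T \<noteq> {} then c (U (SOME Y. Y \<in> G D' T)) else 0)" for T
    have \<chi>: "c (U Y) = \<chi> T" if T: "T \<in> TT" and Y: "Y \<in> G D' T" for T Y
    proof -
      have ne: "G D' T \<noteq> {}" using Y by blast
      then have "(SOME Y. Y \<in> G D' T) \<in> G D' T" by (simp add: some_in_eq)
      moreover obtain x where "\<forall>Y\<in>G D' T. c (U Y) = x" using bspec[OF D'_const T] by (rule exE)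
      ultimately show ?thesis using Y ne by (simp add: \<chi>_def)
    qed
    have "\<chi> T < Suc k" if T: "T \<in> TT" for T
    proof (cases "G D' T = {}")
      case False
      then obtain Y where "Y \<in> G D' T" by blast
      then show ?thesis using \<chi>[OF T] cU[OF T G_sub] by metis
    qed (simp add: \<chi>_def)
    then have "\<chi> \<in> Pow CN \<inter> AN_copies \<rightarrow> {..<Suc k}" unfolding TT_def by simp
    then obtain BN' x where BN': "BN' \<subseteq> CN" "BN' \<in> realizations ar L2 N (induced N BN)"
      and x: "\<And>T. T \<subseteq> BN' \<Longrightarrow> T \<in> AN_copies \<Longrightarrow> \<chi> T = x"
      by (rule arrowE[OF arrow_N]) (rule that)
    obtain g where g: "iso_on ar L2 g N BN N BN'"
      using BN'(2) by (auto simp: realizations_induced_iff)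
    have g_CN: "g i \<in> CN" if "i \<in> BN" for i
      using iso_onD(3)[OF g] that BN'(1) by blast
    have "\<exists>Z\<subseteq>D' (g i). Z \<in> realizations ar L1 (M (g i)) (induced (M i) (B \<inter> univ (M i)))"
      if i: "i \<in> BN" for i
    proof (rule realization_in_copy[OF D'[OF g_CN[OF i]]])
      show "D (g i) \<subseteq> univ (M (g i))" using D[OF g_CN[OF i]] by simp
      show "R i (g i) \<subseteq> D (g i)" using i by (auto simp: D_def)
      show "R i (g i) \<in> realizations ar L1 (M (g i)) (induced (M i) (B \<inter> univ (M i)))"
        by (rule R[OF i g_CN[OF i]])
    qed
    then obtain Z where Z_sub: "\<And>i. i \<in> BN \<Longrightarrow> Z i \<subseteq> D' (g i)"
      and Z: "\<And>i. i \<in> BN \<Longrightarrow> Z i \<in> realizations ar L1 (M (g i)) (induced (M i) (B \<inter> univ (M i)))"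
      by metis
    \<comment> \<open>Inside the homogeneous copy of the index set of \<open>B\<close>, fibres are chosen within \<open>D'\<close>.\<close>
    define W where "W j = Z (inv_into BN g j)" for j
    have W_g: "W (g i) = Z i" if "i \<in> BN" for i
      unfolding W_def using inv_into_f_f[OF iso_onD(2)[OF g] that] by simp
    have W_sub: "W j \<subseteq> D' j" if "j \<in> BN'" for j
      using that W_g Z_sub iso_onD(3)[OF g] by auto
    define B' where "B' = (\<Union>j\<in>BN'. W j)"
    have "B' \<in> realizations ar L I (induced I B)"
      unfolding B'_def
    proof (rule copies_glue[OF B])
      show "BN' \<subseteq> univ N" using BN'(1) CN(2) by blast
      show "iso_on ar L2 g N (idx ` B) N BN'" using g by (simp add: BN_def)
      show "W (g l) \<in> realizations ar L1 (M (g l)) (induced (M l) (B \<inter> univ (M l)))"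
        if "l \<in> idx ` B" for l
        using that W_g[of l] Z[of l] by (simp add: BN_def)
    qed
    moreover have B'_C: "B' \<subseteq> U C"
      unfolding B'_def U_def using W_sub D'_C BN'(1) by blast
    moreover have "c A' = x" if A': "A' \<subseteq> B'" "A' \<in> A_copies" for A'
    proof -
      define T where "T = idx ` A'"
      define Y where "Y = (\<lambda>j\<in>CN. A' \<inter> univ (M j))"
      have A'_C: "A' \<subseteq> U C" using A'(1) B'_C by blast
      note dec = decompose[OF A'(2) A'_C, folded T_def]
      have where_a: "idx a \<in> BN' \<and> a \<in> D' (idx a)" if a: "a \<in> A'" for a
      proof -
        obtain j where j: "j \<in> BN'" "a \<in> D' j" using a A'(1) W_sub unfolding B'_def by blast
        then have "idx a = j" using idx_C D'_C BN'(1) by blast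
        then show ?thesis using j by simp
      qed
      have "A' \<inter> univ (M j) \<subseteq> D' j" if "j \<in> CN" for j
        using where_a idx_eq[of j] that CN(2) by blast
      then have "Y \<in> G D' T" unfolding G_def Y_def using dec(2) by (auto simp: PiE_iff)
      moreover have "U Y = A'"
      proof -
        have "A' \<subseteq> (\<Union>j\<in>CN. univ (M j))" using A'_C C unfolding U_def by blast
        then show ?thesis by (auto simp: U_def Y_def)
      qed
      ultimately have "c A' = \<chi> T" using \<chi>[OF dec(1)] by metis
      moreover have "T \<subseteq> BN'" using where_a by (auto simp: T_def)
      ultimately show ?thesis using x dec(1) by (simp add: TT_def)
    qed
    ultimately show "\<exists>Y\<in>Pow (U C) \<inter> realizations ar L I (induced I B).
        \<exists>x. \<forall>X\<in>Pow Y \<inter> A_copies. c X = x"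
      by (intro bexI[of _ B'] exI[of _ x]) auto
  qed
  then have "arrow k (U C) A_copies (realizations ar L I (induced I B))"
    by (rule arrow_fewer_colours) simp
  moreover have "finite (U C)" using CN(1) C by (auto simp: U_def)
  ultimately show "\<exists>C. finite C \<and> C \<subseteq> univ I \<and>
      arrow k C (realizations ar L I (induced I A)) (realizations ar L I (induced I B))"
    using UC_I unfolding A_copies_def by blast
qed

end

lemma same_age_realizations:
  assumes "age ar L M = age ar L M'" "finite X" "X \<subseteq> univ M"
  shows "realizations ar L M' (induced M X) \<noteq> {}"
proof -
  obtain A where A: "A \<in> age ar L M" "X \<in> realizations ar L M A"
    using finite_subset_in_age[OF assms(2,3)] by blast
  then have "realizations ar L M' (induced M X) = realizations ar L M' A"
    by (intro realizations_cong) (simp add: realizations_def)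
  then show ?thesis using A(1) assms(1) by (simp add: in_age_iff)
qed

theorem theorem5p13:
  fixes ar :: "'s \<Rightarrow> nat" and L1 L2 :: "'s set" and p E :: 's
    and N :: "('i, 's) rstruct" and M :: "'i \<Rightarrow> ('a, 's) rstruct"
    and M0 :: "('b, 's) rstruct" and K :: "(nat, 's) rstruct set"
  assumes "L1 \<inter> L2 = {p}" and "ar p = 2"
    and "E \<notin> L1 \<union> L2" and "ar E = 2"
    and "is_rstruct ar L2 N" and "ordered_by p N"
    and "\<And>i. i \<in> univ N \<Longrightarrow> is_rstruct ar L1 (M i)"
    and "\<And>i. i \<in> univ N \<Longrightarrow> ordered_by p (M i)"
    and "disjoint_family_on (\<lambda>i. univ (M i)) (univ N)"
    and "is_rstruct ar L1 M0" and "K = age ar L1 M0"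
    and "class_RP ar L1 K"
    and "\<And>i. i \<in> univ N \<Longrightarrow> age ar L1 (M i) = K"
    and "RP ar L2 N"
  shows "RP ar (L1 \<union> L2 \<union> {E}) (semidirect ar L1 L2 p E N M)"
proof -
  have same_age: "realizations ar L1 (M j) (induced (M i) X) \<noteq> {}"
    if "i \<in> univ N" "j \<in> univ N" "finite X" "X \<subseteq> univ (M i)" for i j X
    using assms(13)[OF that(1)] assms(13)[OF that(2)] that(3,4)
    by (intro same_age_realizations) simp_all
  have nullary: "[] \<in> interp (M i) S \<longleftrightarrow> [] \<in> interp (M j) S"
    if "i \<in> univ N" "j \<in> univ N" "S \<in> L1" "ar S = 0" for i j S
  proof -
    have "realizations ar L1 (M j) (induced (M i) {}) \<noteq> {}"
      using that(1,2) by (intro same_age) simp_all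
    then obtain f X where "iso_on ar L1 f (M i) {} (M j) X"
      by (auto simp: realizations_induced_iff)
    from iso_onD(4)[OF this that(3), of "[]"] show ?thesis using that(4) by simp
  qed
  interpret semidirect_family ar L1 L2 p E N M
    by unfold_locales (fact assms(1-4,6,7,9) nullary)+
  have ramsey_M: "ramsey ar L1 (M i)" if "i \<in> univ N" for i
    using assms(12) unfolding assms(13)[OF that, symmetric] class_RP_age_iff .
  have ramsey_N: "ramsey ar L2 N"
    using assms(14) unfolding RP_def class_RP_age_iff .
  show ?thesis
    unfolding RP_def class_RP_age_iff
    by (rule ramsey_semidirect) (fact ramsey_N ramsey_M same_age)+
qed

end
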